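(* Let $\mathbb{K}$ be a field, $N\geq 1$ and $a=(a_1,\ldots,a_N)\in\mathbb{K}^N$. The symmetric algebra $S(\mathfrak{g}_a)$ is given an associative product $\blacktriangleleft$ such that for all $k,l\geq 0$ and all $i_1,\ldots,i_k,j_1,\ldots,j_l\in\{1,\ldots,N\}$: $$\epsilon_{i_1}\ldots\epsilon_{i_k}\blacktriangleleft\epsilon_{j_1}\ldots\epsilon_{j_l}=\sum_{I\subseteq\{1,\ldots,l\}}k(k-1)\ldots(k-|I|+1)\left(\prod_{q\in I}a_{j_q}\right)\left(\prod_{p\notin I}\epsilon_{j_p}\right)\epsilon_{i_1}\ldots\epsilon_{i_k},$$ where the products on the right-hand side are in the commutative algebra $S(\mathfrak{g}_a)$. The Hopf algebra $(S(\mathfrak{g}_a),\blacktriangleleft,\Delta)$ is isomorphic to the enveloping algebra of the Lie algebra $\mathfrak{g}_a$.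
   Context: $(\epsilon_1,\ldots,\epsilon_N)$ is the canonical basis of $\mathbb{K}^N$. $\mathfrak{g}_a$ is the vector space $\mathbb{K}^N$ with the Lie bracket $[\epsilon_i,\epsilon_j]_a=a_j\epsilon_i-a_i\epsilon_j$ (the commutator of the associative product $\epsilon_i\triangleleft\epsilon_j=a_j\epsilon_i$). $\Delta$ is the usual coproduct of $S(\mathfrak{g}_a)$, the morphism of commutative algebras for which the elements of $\mathfrak{g}_a$ are primitive. For $|I|=0$ the coefficient $k(k-1)\ldots(k-|I|+1)$ is $1$. *)

theory Defs
  imports
    "HOL-Analysis.Finite_Cartesian_Product"
    "HOL-Library.Poly_Mapping"
    "HOL-Library.Product_Plus"
    "HOL-Algebra.Module"
    "HOL-Algebra.QuotRing"
    "HOL-Algebra.Algebraic_Closure_Type"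
begin

section \<open>Formal linear combinations\<close>

text \<open>The type \<open>'x \<Rightarrow>\<^sub>0 'k\<close> is the \<open>'k\<close>-vector space with basis \<open>'x\<close>; if \<open>'x\<close> is a
  monoid (written additively), its library multiplication is that of the monoid algebra.\<close>

definition scale_pm :: "'k::field \<Rightarrow> ('x \<Rightarrow>\<^sub>0 'k) \<Rightarrow> ('x \<Rightarrow>\<^sub>0 'k)" where
  "scale_pm c = Poly_Mapping.map ((*) c)"

definition lin_ext :: "('x \<Rightarrow> 'y \<Rightarrow>\<^sub>0 'k::field) \<Rightarrow> ('x \<Rightarrow>\<^sub>0 'k) \<Rightarrow> ('y \<Rightarrow>\<^sub>0 'k)" where
  "lin_ext f p = (\<Sum>x\<in>Poly_Mapping.keys p. scale_pm (Poly_Mapping.lookup p x) (f x))"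

definition bilinear_pm :: "(('x \<Rightarrow>\<^sub>0 'k::field) \<Rightarrow> ('x \<Rightarrow>\<^sub>0 'k) \<Rightarrow> ('x \<Rightarrow>\<^sub>0 'k)) \<Rightarrow> bool" where
  "bilinear_pm f \<longleftrightarrow>
    (\<forall>p q r. f (p + q) r = f p r + f q r \<and> f r (p + q) = f r p + f r q) \<and>
    (\<forall>c p q. f (scale_pm c p) q = scale_pm c (f p q) \<and> f p (scale_pm c q) = scale_pm c (f p q))"


section \<open>Tensor powers and Hopf algebras\<close>

text \<open>The field of scalars is the type \<open>'k\<close>; the algebra itself has an explicit carrier.
  Elements of \<open>H \<otimes> H\<close> and \<open>H \<otimes> H \<otimes> H\<close> are represented by formal linear combinations of pairs
  and triples of elements of \<open>H\<close>. Two such combinations represent the same tensor iff their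
  difference lies in the subspace spanned by the multilinearity relations. In particular
  \<open>comult H x\<close> is a representative of the coproduct of \<open>x\<close>, and identities between tensors
  are stated with \<open>tensor2_eq\<close> and \<open>tensor3_eq\<close> instead of equality.\<close>

record (overloaded) ('k::zero, 'h) hopf = "('k, 'h) module" +
  comult :: "'h \<Rightarrow> ('h \<times> 'h \<Rightarrow>\<^sub>0 'k)"
  counit :: "'h \<Rightarrow> 'k"

definition slot_relators ::
  "('k::field, 'h, 'm) module_scheme \<Rightarrow> ('h \<Rightarrow> 'z) \<Rightarrow> ('z \<Rightarrow>\<^sub>0 'k) set" where
  "slot_relators H f =
    {Poly_Mapping.single (f (x \<oplus>\<^bsub>H\<^esub> y)) 1 - Poly_Mapping.single (f x) 1 - Poly_Mapping.single (f y) 1 |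
      x y. x \<in> carrier H \<and> y \<in> carrier H} \<union>
    {Poly_Mapping.single (f (c \<odot>\<^bsub>H\<^esub> x)) 1 - Poly_Mapping.single (f x) c | c x. x \<in> carrier H}"

definition tensor2_eq ::
  "('k::field, 'h, 'm) module_scheme \<Rightarrow> ('h \<times> 'h \<Rightarrow>\<^sub>0 'k) \<Rightarrow> ('h \<times> 'h \<Rightarrow>\<^sub>0 'k) \<Rightarrow> bool" where
  "tensor2_eq H p q \<longleftrightarrow> p - q \<in> Modules.module.span scale_pm
    (\<Union>u\<in>carrier H. slot_relators H (\<lambda>x. (x, u)) \<union> slot_relators H (\<lambda>x. (u, x)))"

definition tensor3_eq ::
  "('k::field, 'h, 'm) module_scheme \<Rightarrow>
    ('h \<times> 'h \<times> 'h \<Rightarrow>\<^sub>0 'k) \<Rightarrow> ('h \<times> 'h \<times> 'h \<Rightarrow>\<^sub>0 'k) \<Rightarrow> bool" where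
  "tensor3_eq H p q \<longleftrightarrow> p - q \<in> Modules.module.span scale_pm
    (\<Union>u\<in>carrier H. \<Union>v\<in>carrier H. slot_relators H (\<lambda>x. (x, u, v)) \<union>
      slot_relators H (\<lambda>x. (u, x, v)) \<union> slot_relators H (\<lambda>x. (u, v, x)))"

definition tensor2_mult ::
  "('k::field, 'h, 'm) module_scheme \<Rightarrow> ('h \<times> 'h \<Rightarrow>\<^sub>0 'k) \<Rightarrow> ('h \<times> 'h \<Rightarrow>\<^sub>0 'k) \<Rightarrow> ('h \<times> 'h \<Rightarrow>\<^sub>0 'k)" where
  "tensor2_mult H p q = lin_ext (\<lambda>(x, y). lin_ext (\<lambda>(x', y').
    Poly_Mapping.single (x \<otimes>\<^bsub>H\<^esub> x', y \<otimes>\<^bsub>H\<^esub> y') 1) q) p"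

definition tensor2_eval ::
  "('k::field, 'h, 'm) module_scheme \<Rightarrow> ('h \<Rightarrow> 'h \<Rightarrow> 'h) \<Rightarrow> ('h \<times> 'h \<Rightarrow>\<^sub>0 'k) \<Rightarrow> 'h" where
  "tensor2_eval H f p = finsum H (\<lambda>(x, y). Poly_Mapping.lookup p (x, y) \<odot>\<^bsub>H\<^esub> f x y) (Poly_Mapping.keys p)"

definition is_antipode :: "('k::field, 'h, 'm) hopf_scheme \<Rightarrow> ('h \<Rightarrow> 'h) \<Rightarrow> bool" where
  "is_antipode H s \<longleftrightarrow>
    (\<forall>x\<in>carrier H. s x \<in> carrier H) \<and>
    (\<forall>x\<in>carrier H. \<forall>y\<in>carrier H. s (x \<oplus>\<^bsub>H\<^esub> y) = s x \<oplus>\<^bsub>H\<^esub> s y) \<and>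
    (\<forall>c. \<forall>x\<in>carrier H. s (c \<odot>\<^bsub>H\<^esub> x) = c \<odot>\<^bsub>H\<^esub> s x) \<and>
    (\<forall>x\<in>carrier H.
      tensor2_eval H (\<lambda>y z. s y \<otimes>\<^bsub>H\<^esub> z) (comult H x) = counit H x \<odot>\<^bsub>H\<^esub> \<one>\<^bsub>H\<^esub> \<and>
      tensor2_eval H (\<lambda>y z. y \<otimes>\<^bsub>H\<^esub> s z) (comult H x) = counit H x \<odot>\<^bsub>H\<^esub> \<one>\<^bsub>H\<^esub>)"

locale hopf_algebra =
  ring H + scalars: Module.module ring_of_type_algebra H
  for H :: "('k::field, 'h, 'm) hopf_scheme" (structure) +
  assumes smult_mult_left:
      "\<lbrakk>x \<in> carrier H; y \<in> carrier H\<rbrakk> \<Longrightarrow> (c \<odot> x) \<otimes> y = c \<odot> (x \<otimes> y)"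
    and smult_mult_right:
      "\<lbrakk>x \<in> carrier H; y \<in> carrier H\<rbrakk> \<Longrightarrow> x \<otimes> (c \<odot> y) = c \<odot> (x \<otimes> y)"
    and comult_closed: "x \<in> carrier H \<Longrightarrow> Poly_Mapping.keys (comult H x) \<subseteq> carrier H \<times> carrier H"
    and comult_add: "\<lbrakk>x \<in> carrier H; y \<in> carrier H\<rbrakk> \<Longrightarrow>
      tensor2_eq H (comult H (x \<oplus> y)) (comult H x + comult H y)"
    and comult_smult: "x \<in> carrier H \<Longrightarrow>
      tensor2_eq H (comult H (c \<odot> x)) (scale_pm c (comult H x))"
    and coassoc: "x \<in> carrier H \<Longrightarrow> tensor3_eq H
      (lin_ext (\<lambda>(y, z). lin_ext (\<lambda>(u, v). Poly_Mapping.single (u, v, z) 1) (comult H y)) (comult H x))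
      (lin_ext (\<lambda>(y, z). lin_ext (\<lambda>(u, v). Poly_Mapping.single (y, u, v) 1) (comult H z)) (comult H x))"
    and counit_add: "\<lbrakk>x \<in> carrier H; y \<in> carrier H\<rbrakk> \<Longrightarrow> counit H (x \<oplus> y) = counit H x + counit H y"
    and counit_smult: "x \<in> carrier H \<Longrightarrow> counit H (c \<odot> x) = c * counit H x"
    and counit_left: "x \<in> carrier H \<Longrightarrow>
      tensor2_eval H (\<lambda>y z. counit H y \<odot> z) (comult H x) = x"
    and counit_right: "x \<in> carrier H \<Longrightarrow>
      tensor2_eval H (\<lambda>y z. counit H z \<odot> y) (comult H x) = x"
    and comult_mult: "\<lbrakk>x \<in> carrier H; y \<in> carrier H\<rbrakk> \<Longrightarrow>
      tensor2_eq H (comult H (x \<otimes> y)) (tensor2_mult H (comult H x) (comult H y))"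
    and comult_one: "tensor2_eq H (comult H \<one>) (Poly_Mapping.single (\<one>, \<one>) 1)"
    and counit_mult: "\<lbrakk>x \<in> carrier H; y \<in> carrier H\<rbrakk> \<Longrightarrow> counit H (x \<otimes> y) = counit H x * counit H y"
    and counit_one: "counit H \<one> = 1"
    and antipode_exists: "\<exists>s. is_antipode H s"

text \<open>Compatibility with the antipodes is automatic for such a map.\<close>

definition hopf_iso ::
  "('k::field, 'h, 'm) hopf_scheme \<Rightarrow> ('k, 'l, 'n) hopf_scheme \<Rightarrow> ('h \<Rightarrow> 'l) set" where
  "hopf_iso H L = {f \<in> ring_iso H L.
    (\<forall>c. \<forall>x\<in>carrier H. f (c \<odot>\<^bsub>H\<^esub> x) = c \<odot>\<^bsub>L\<^esub> f x) \<and>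
    (\<forall>x\<in>carrier H. counit L (f x) = counit H x) \<and>
    (\<forall>x\<in>carrier H. tensor2_eq L (comult L (f x))
      (lin_ext (\<lambda>(y, z). Poly_Mapping.single (f y, f z) 1) (comult H x)))}"


section \<open>The enveloping algebra of a Lie algebra\<close>

text \<open>Lists form the free monoid, so \<open>'v list \<Rightarrow>\<^sub>0 'k\<close> is the free associative algebra on the
  set \<open>'v\<close>.\<close>

instantiation list :: (type) monoid_add
begin
definition plus_list :: "'a list \<Rightarrow> 'a list \<Rightarrow> 'a list" where "plus_list = (@)"
definition zero_list :: "'a list" where "zero_list = []"
instance by standard (simp_all add: plus_list_def zero_list_def)
end

definition free_gen :: "'v \<Rightarrow> ('v list \<Rightarrow>\<^sub>0 'k::field)" where
  "free_gen x = Poly_Mapping.single [x] 1"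

text \<open>\<open>scl\<close> and \<open>br\<close> are the scalar multiplication and the Lie bracket on the vector space \<open>'v\<close>.
  The quotient of the free algebra by the first two families of relators alone is the tensor
  algebra of this vector space.\<close>

definition env_relators ::
  "('k::field \<Rightarrow> 'v \<Rightarrow> 'v) \<Rightarrow> ('v \<Rightarrow> 'v \<Rightarrow> 'v) \<Rightarrow> ('v::ab_group_add list \<Rightarrow>\<^sub>0 'k) set" where
  "env_relators scl br =
    {free_gen (x + y) - free_gen x - free_gen y | x y. True} \<union>
    {free_gen (scl c x) - scale_pm c (free_gen x) | c x. True} \<union>
    {free_gen x * free_gen y - free_gen y * free_gen x - free_gen (br x y) | x y. True}"

definition env_ideal ::
  "('k::field \<Rightarrow> 'v \<Rightarrow> 'v) \<Rightarrow> ('v \<Rightarrow> 'v \<Rightarrow> 'v) \<Rightarrow> ('v::ab_group_add list \<Rightarrow>\<^sub>0 'k) set" where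
  "env_ideal scl br = genideal ring_of_type_algebra (env_relators scl br)"

definition env_class ::
  "('k::field \<Rightarrow> 'v \<Rightarrow> 'v) \<Rightarrow> ('v \<Rightarrow> 'v \<Rightarrow> 'v) \<Rightarrow> ('v::ab_group_add list \<Rightarrow>\<^sub>0 'k) \<Rightarrow> ('v list \<Rightarrow>\<^sub>0 'k) set" where
  "env_class scl br t = env_ideal scl br +>\<^bsub>ring_of_type_algebra\<^esub> t"

text \<open>The coproduct of the free algebra: \<open>('v list \<times> 'v list) \<Rightarrow>\<^sub>0 'k\<close> is the tensor square of the
  free algebra, and \<open>free_comult\<close> is the algebra morphism for which the letters are primitive.\<close>

definition free_comult :: "('v list \<Rightarrow>\<^sub>0 'k::field) \<Rightarrow> ('v list \<times> 'v list \<Rightarrow>\<^sub>0 'k)" where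
  "free_comult = lin_ext (\<lambda>w. prod_list
    (map (\<lambda>x. Poly_Mapping.single ([x], []) 1 + Poly_Mapping.single ([], [x]) 1) w))"

text \<open>Coproduct and counit of a class are read off from an arbitrary element of the class. The
  counit does not depend on this choice, nor does the coproduct up to \<open>tensor2_eq\<close>, because the
  ideal is a Hopf ideal of the free algebra.\<close>

definition env_hopf ::
  "('k::field \<Rightarrow> 'v \<Rightarrow> 'v) \<Rightarrow> ('v \<Rightarrow> 'v \<Rightarrow> 'v) \<Rightarrow> ('k, ('v::ab_group_add list \<Rightarrow>\<^sub>0 'k) set) hopf" where
  "env_hopf scl br =
    (let U = ring_of_type_algebra Quot env_ideal scl br in
      \<lparr>carrier = carrier U, monoid.mult = monoid.mult U, one = one U, ring.zero = ring.zero U, add = add U,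
       module.smult = (\<lambda>c C. \<Union>t\<in>C. env_class scl br (scale_pm c t)),
       comult = (\<lambda>C. lin_ext
         (\<lambda>(u, v). Poly_Mapping.single
           (env_class scl br (Poly_Mapping.single u 1), env_class scl br (Poly_Mapping.single v 1)) 1)
         (free_comult (SOME t. t \<in> C))),
       counit = (\<lambda>C. Poly_Mapping.lookup (SOME t. t \<in> C) [])\<rparr>)"


section \<open>The symmetric algebra and the Lie algebra\<close>

text \<open>The symmetric algebra of \<open>'k ^ 'n\<close> is the polynomial algebra on its canonical basis; the
  monoid of monomials is \<open>'n \<Rightarrow>\<^sub>0 nat\<close>.\<close>

type_synonym ('n, 'k) sym = "('n \<Rightarrow>\<^sub>0 nat) \<Rightarrow>\<^sub>0 'k"

definition sym_gen :: "'n \<Rightarrow> ('n, 'k::field) sym" where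
  "sym_gen i = Poly_Mapping.single (Poly_Mapping.single i 1) 1"

text \<open>The tensor square of the symmetric algebra is the algebra of the monoid of pairs of
  monomials. \<open>sym_comult_alg\<close> is the morphism of commutative algebras sending each \<open>sym_gen i\<close>
  to \<open>sym_gen i \<otimes> 1 + 1 \<otimes> sym_gen i\<close>.\<close>

definition sym_comult_alg ::
  "('n::finite, 'k::field) sym \<Rightarrow> (('n \<Rightarrow>\<^sub>0 nat) \<times> ('n \<Rightarrow>\<^sub>0 nat) \<Rightarrow>\<^sub>0 'k)" where
  "sym_comult_alg = lin_ext (\<lambda>m. \<Prod>i\<in>UNIV.
    (Poly_Mapping.single (Poly_Mapping.single i 1, 0) 1
      + Poly_Mapping.single (0, Poly_Mapping.single i 1) 1) ^ Poly_Mapping.lookup m i)"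

definition sym_hopf ::
  "(('n::finite, 'k::field) sym \<Rightarrow> ('n, 'k) sym \<Rightarrow> ('n, 'k) sym) \<Rightarrow> ('k, ('n, 'k) sym) hopf" where
  "sym_hopf tri =
    \<lparr>carrier = UNIV, monoid.mult = tri, one = 1, ring.zero = 0, add = (+),
     module.smult = scale_pm,
     comult = (\<lambda>p. lin_ext
       (\<lambda>(m, n). Poly_Mapping.single (Poly_Mapping.single m 1, Poly_Mapping.single n 1) 1)
       (sym_comult_alg p)),
     counit = (\<lambda>p. Poly_Mapping.lookup p 0)\<rparr>"

definition ga_bracket :: "'k::field ^ 'n::finite \<Rightarrow> 'k ^ 'n \<Rightarrow> 'k ^ 'n \<Rightarrow> 'k ^ 'n" where
  "ga_bracket a x y =
    (\<Sum>i\<in>UNIV. \<Sum>j\<in>UNIV. (x $ i * y $ j) *s (a $ j *s axis i 1 - a $ i *s axis j 1))"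

text \<open>The indices \<open>i\<^sub>1, \<dots>, i\<^sub>k\<close> and \<open>j\<^sub>1, \<dots>, j\<^sub>l\<close> form the lists \<open>is\<close> and \<open>js\<close>; positions in
  \<open>js\<close> are counted from \<open>0\<close>.\<close>

definition black_product ::
  "'k::field ^ 'n::finite \<Rightarrow> (('n, 'k) sym \<Rightarrow> ('n, 'k) sym \<Rightarrow> ('n, 'k) sym) \<Rightarrow> bool" where
  "black_product a tri \<longleftrightarrow> bilinear_pm tri \<and>
    (\<forall>is js. tri (\<Prod>i\<leftarrow>is. sym_gen i) (\<Prod>j\<leftarrow>js. sym_gen j) =
      (\<Sum>I\<in>Pow {..<length js}.
        scale_pm ((\<Prod>r<card I. of_nat (length is) - of_nat r) * (\<Prod>q\<in>I. a $ (js ! q)))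
          ((\<Prod>p\<in>{..<length js} - I. sym_gen (js ! p)) * (\<Prod>i\<leftarrow>is. sym_gen i))))"

end

theory Submission
  imports Defs
begin

text \<open>Let \<open>D\<close> be the derivation \<open>\<Sum>\<^sub>j a\<^sub>j \<partial>\<^sub>j\<close> of the polynomial algebra and \<open>T = 1 + D\<close>. The formula for the product
  says \<open>x \<triangleleft> y = x T\<^sup>k y\<close> for a monomial \<open>x\<close> of degree \<open>k\<close>, and \<open>T\<close> is an endomorphism for \<open>\<triangleleft>\<close>; this gives
  associativity. In particular \<open>m \<triangleleft> \<epsilon>\<^sub>j = m (\<epsilon>\<^sub>j + k a\<^sub>j)\<close> for a monomial \<open>m\<close> of degree \<open>k\<close>, so that \<open>S\<close> is generated
  by the \<open>\<epsilon>\<^sub>j\<close> and every Hopf identity can be checked by multiplying with one generator at a time.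
  Conversely, modulo the defining ideal of the enveloping algebra, the noncommutative product
  \<open>\<epsilon>\<^sub>i (\<epsilon>\<^sub>j - a\<^sub>j) (\<epsilon>\<^sub>k - 2 a\<^sub>k) \<dots>\<close> does not depend on the order of the indices \<open>i, j, k, \<dots>\<close>. These products
  provide a linear section of the morphism from the free algebra onto \<open>(S, \<triangleleft>)\<close>, whose kernel is
  therefore exactly that ideal; no appeal to the Poincare-Birkhoff-Witt theorem is needed.\<close>

section \<open>Linear maps on formal linear combinations\<close>

text \<open>Since D maps \<open>\<epsilon>\<^sub>j\<close> to the scalar \<open>a\<^sub>j\<close>,
  the commutator of T with multiplication by \<open>\<epsilon>\<^sub>j\<close> is
  \<open>a\<^sub>j\<close>, and that of \<open>T\<^sup>k\<close> is k \<open>a\<^sub>j\<close>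
  \<open>T\<^sup>k\<^sup>-\<^sup>1\<close>; iterating this produces the falling factorials. T
  respects \<triangleleft> because D lowers the degree by one: the power of T that D m loses is
  returned by the T applied to the right factor. The factors \<open>\<epsilon>\<^sub>j\<close> - r
  \<open>a\<^sub>j\<close> come from solving the formula for m \<triangleleft>
  \<open>\<epsilon>\<^sub>j\<close> for the commutative product m \<open>\<epsilon>\<^sub>j\<close>,
  where r is the degree of m. One extension principle, \<open>sym_lift\<close>, builds both linear
  maps that are not given by a formula: the antipode, where the relations hold exactly, and the
  section into the free algebra, where they hold modulo the ideal. The obstacle is the encoding of
  tensors as formal combinations of carrier elements modulo multilinearity, with a coproduct of
  classes read off from a chosen representative. Moving every tensor slot to S turns such identities
  into plain equations between combinations of pairs of monomials.\<close>

lemma lookup_scale_pm [simp]: "Poly_Mapping.lookup (scale_pm c p) x = c * Poly_Mapping.lookup p x"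
  by (simp add: scale_pm_def Poly_Mapping.map.rep_eq when_def)

lemma scale_pm_single [simp]: "scale_pm c (Poly_Mapping.single x d) = Poly_Mapping.single x (c * d)"
  by (rule poly_mapping_eqI) (simp add: lookup_single when_def)

global_interpretation pm: vector_space "scale_pm :: 'k::field \<Rightarrow> ('x \<Rightarrow>\<^sub>0 'k) \<Rightarrow> 'x \<Rightarrow>\<^sub>0 'k"
  by standard (auto intro!: poly_mapping_eqI simp: lookup_add algebra_simps)

global_interpretation pmp: vector_space_pair
    "scale_pm :: 'k::field \<Rightarrow> ('x \<Rightarrow>\<^sub>0 'k) \<Rightarrow> 'x \<Rightarrow>\<^sub>0 'k"
    "scale_pm :: 'k::field \<Rightarrow> ('y \<Rightarrow>\<^sub>0 'k) \<Rightarrow> 'y \<Rightarrow>\<^sub>0 'k"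
  by standard

abbreviation pm_linear :: "(('x \<Rightarrow>\<^sub>0 'k::field) \<Rightarrow> ('y \<Rightarrow>\<^sub>0 'k)) \<Rightarrow> bool" where
  "pm_linear \<equiv> Vector_Spaces.linear scale_pm scale_pm"

lemmas pm_linear_add = pmp.linear_add
lemmas pm_linear_scale = pmp.linear_scale
lemmas pm_linear_0 = pmp.linear_0
lemmas pm_linear_sum = pmp.linear_sum
lemmas pm_linear_diff = pmp.linear_diff
lemmas pm_linear_neg = pmp.linear_neg

lemma pm_linearI:
  "(\<And>p q. f (p + q) = f p + f q) \<Longrightarrow> (\<And>c p. f (scale_pm c p) = scale_pm c (f p)) \<Longrightarrow> pm_linear f"
  by unfold_locales auto

lemma pm_as_sum: "p = (\<Sum>x\<in>Poly_Mapping.keys p. scale_pm (Poly_Mapping.lookup p x) (Poly_Mapping.single x 1))"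
proof (rule poly_mapping_eqI)
  fix y
  have "Poly_Mapping.lookup (\<Sum>x\<in>Poly_Mapping.keys p. scale_pm (Poly_Mapping.lookup p x) (Poly_Mapping.single x 1)) y
     = (\<Sum>x\<in>Poly_Mapping.keys p. if x = y then Poly_Mapping.lookup p x else 0)"
    by (simp add: lookup_sum lookup_single when_def)
  also have "\<dots> = Poly_Mapping.lookup p y" by (simp add: in_keys_iff)
  finally show "Poly_Mapping.lookup p y = Poly_Mapping.lookup (\<Sum>x\<in>Poly_Mapping.keys p. scale_pm (Poly_Mapping.lookup p x) (Poly_Mapping.single x 1)) y" by simp
qed

lemma pm_induct [case_names zero basis add scale]:
  assumes "P 0" "\<And>x. P (Poly_Mapping.single x 1)" "\<And>p q. P p \<Longrightarrow> P q \<Longrightarrow> P (p + q)"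
    "\<And>c p. P p \<Longrightarrow> P (scale_pm c p)"
  shows "P (p :: 'x \<Rightarrow>\<^sub>0 'k::field)"
proof -
  have "P (\<Sum>x\<in>A. scale_pm (Poly_Mapping.lookup p x) (Poly_Mapping.single x 1))" if "finite A" for A
    using that by (induction A) (simp_all add: assms del: scale_pm_single)
  then show ?thesis using pm_as_sum[of p] by (metis finite_keys)
qed

lemma lin_ext_alt:
  assumes "finite A" "Poly_Mapping.keys p \<subseteq> A"
  shows "lin_ext f p = (\<Sum>x\<in>A. scale_pm (Poly_Mapping.lookup p x) (f x))"
  unfolding lin_ext_def using assms by (intro sum.mono_neutral_left) (auto simp: in_keys_iff)

lemma pm_linear_lin_ext [simp]:
  fixes f :: "'x \<Rightarrow> 'y \<Rightarrow>\<^sub>0 'k::field"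
  shows "pm_linear (lin_ext f)"
proof (rule pm_linearI)
  fix p q :: "'x \<Rightarrow>\<^sub>0 'k"
  let ?A = "Poly_Mapping.keys p \<union> Poly_Mapping.keys q"
  show "lin_ext f (p + q) = lin_ext f p + lin_ext f q"
    using keys_add[of p q]
    by (subst (1 2 3) lin_ext_alt[of ?A]) (auto simp: lookup_add pm.scale_left_distrib sum.distrib)
next
  fix c and p :: "'x \<Rightarrow>\<^sub>0 'k"
  show "lin_ext f (scale_pm c p) = scale_pm c (lin_ext f p)"
    by (subst (1 2) lin_ext_alt[of "Poly_Mapping.keys p"]) (auto simp: in_keys_iff pm.scale_sum_right)
qed

lemmas lin_ext_add = pm_linear_add[OF pm_linear_lin_ext]
lemmas lin_ext_scale = pm_linear_scale[OF pm_linear_lin_ext]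
lemmas lin_ext_zero [simp] = pm_linear_0[OF pm_linear_lin_ext]

lemma lin_ext_single [simp]: "lin_ext f (Poly_Mapping.single x c) = scale_pm c (f x)"
  by (simp add: lin_ext_def)

lemma lin_ext_one [simp]: "lin_ext f 1 = f 0"
  using lin_ext_single[of f 0 1] by simp

text \<open>Gives linearity in the second argument of operations defined by extension in the first
  one, such as \<open>tens\<close> and \<open>black_prod\<close>.\<close>

lemma pm_linear_lin_ext_fun:
  assumes "\<And>x. pm_linear (\<lambda>q. f q x)"
  shows "pm_linear (\<lambda>q. lin_ext (f q) p)"
  unfolding lin_ext_def
  by (rule pm_linearI)
     (simp_all add: pm_linear_add[OF assms] pm_linear_scale[OF assms] pm.scale_right_distrib
        sum.distrib pm.scale_sum_right mult.commute)

lemma pm_linear_comp: "pm_linear f \<Longrightarrow> pm_linear g \<Longrightarrow> pm_linear (\<lambda>p. f (g p))"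
  by (rule pm_linearI) (simp_all add: pm_linear_add pm_linear_scale)

lemma pm_linear_lin_ext_comp: "pm_linear g \<Longrightarrow> pm_linear (\<lambda>p. lin_ext f (g p))"
  by (rule pm_linear_comp) simp_all

lemma pm_linear_id: "pm_linear (\<lambda>p. p)"
  by (rule pm_linearI) auto

lemma pm_linear_sum_fun: "pm_linear f \<Longrightarrow> pm_linear g \<Longrightarrow> pm_linear (\<lambda>p. f p + g p)"
  by (rule pm_linearI) (simp_all add: pm_linear_add pm_linear_scale pm.scale_right_distrib)

lemma pm_linear_scale_fun: "pm_linear f \<Longrightarrow> pm_linear (\<lambda>p. scale_pm c (f p))"
  by (rule pm_linearI) (simp_all add: pm_linear_add pm_linear_scale pm.scale_right_distrib mult.commute)

text \<open>Scalars become ring elements, so that they move through products by associativity and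
  ideals are seen to be subspaces.\<close>

lemma scale_pm_conv_mult: "scale_pm c p = Poly_Mapping.single 0 c * (p :: 'm::monoid_add \<Rightarrow>\<^sub>0 'k::field)"
  unfolding scale_pm_def by (rule mult_map_scale_conv_mult)

lemma scale_pm_mult_left: "scale_pm c p * q = scale_pm c (p * (q :: 'm::monoid_add \<Rightarrow>\<^sub>0 'k::field))"
  by (simp add: scale_pm_conv_mult mult.assoc)

text \<open>The monoid may be noncommutative, as for words; scalars are still central because they
  sit on its neutral element and the field is commutative.\<close>

lemma single_zero_commute:
  "p * Poly_Mapping.single 0 c = Poly_Mapping.single 0 c * (p :: 'm::monoid_add \<Rightarrow>\<^sub>0 'k::field)"
proof (induction p rule: pm_induct)
  case (scale d p)
  have "scale_pm d p * Poly_Mapping.single 0 c = scale_pm d (p * Poly_Mapping.single 0 c)"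
    by (rule scale_pm_mult_left)
  also have "\<dots> = Poly_Mapping.single 0 (d * c) * p"
    by (simp only: scale scale_pm_conv_mult mult.assoc[symmetric] mult_single add_0)
  also have "\<dots> = Poly_Mapping.single 0 c * scale_pm d p"
    by (simp only: scale_pm_conv_mult mult.assoc[symmetric] mult_single add_0 mult.commute[of d])
  finally show ?case .
qed (simp_all add: mult_single distrib_left distrib_right mult.commute)

lemma scale_pm_mult_right: "p * scale_pm c q = scale_pm c (p * (q :: 'm::monoid_add \<Rightarrow>\<^sub>0 'k::field))"
  by (simp add: scale_pm_conv_mult single_zero_commute flip: mult.assoc)

lemma pm_linear_mult_left: "pm_linear f \<Longrightarrow> pm_linear (\<lambda>p. (q :: 'm::monoid_add \<Rightarrow>\<^sub>0 'k::field) * f p)"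
  by (rule pm_linearI) (simp_all add: pm_linear_add pm_linear_scale distrib_left scale_pm_mult_right)

lemma pm_linear_mult_right: "pm_linear f \<Longrightarrow> pm_linear (\<lambda>p. f p * (q :: 'm::monoid_add \<Rightarrow>\<^sub>0 'k::field))"
  by (rule pm_linearI) (simp_all add: pm_linear_add pm_linear_scale distrib_right scale_pm_mult_left)

lemma pm_linear_eq:
  assumes "pm_linear f" "pm_linear g" "\<And>x. f (Poly_Mapping.single x 1) = g (Poly_Mapping.single x 1)"
  shows "f p = g p"
  by (induction p rule: pm_induct)
     (simp_all add: assms(3) pm_linear_0[OF assms(1)] pm_linear_0[OF assms(2)]
        pm_linear_add[OF assms(1)] pm_linear_add[OF assms(2)]
        pm_linear_scale[OF assms(1)] pm_linear_scale[OF assms(2)])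

lemma linear_lin_ext:
  assumes "pm_linear f"
  shows "f (lin_ext h p) = lin_ext (\<lambda>x. f (h x)) p"
  by (rule pm_linear_eq[where f = "\<lambda>p. f (lin_ext h p)" and g = "lin_ext (\<lambda>x. f (h x))"])
     (simp_all add: pm_linear_comp[OF assms])

lemma lin_ext_lin_ext: "lin_ext f (lin_ext h p) = lin_ext (\<lambda>x. lin_ext f (h x)) p"
  by (rule linear_lin_ext[where f = "lin_ext f"]) simp

lemma lin_ext_basis: "pm_linear f \<Longrightarrow> lin_ext (\<lambda>x. f (Poly_Mapping.single x 1)) p = f p"
  by (rule pm_linear_eq[where p = p]) simp_all

lemma lin_ext_id [simp]: "lin_ext (\<lambda>x. Poly_Mapping.single x 1) p = p"
  by (rule lin_ext_basis[OF pm_linear_id])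

text \<open>The universal property of the monoid algebra.\<close>

lemma lin_ext_mult:
  fixes f :: "'x::monoid_add \<Rightarrow> 'y::monoid_add \<Rightarrow>\<^sub>0 'k::field"
  assumes "\<And>x y. f (x + y) = f x * f y"
  shows "lin_ext f (p * q) = lin_ext f p * lin_ext f q"
proof (induction p rule: pm_induct)
  case (basis x)
  show ?case
    by (rule pm_linear_eq[of "\<lambda>q. lin_ext f (Poly_Mapping.single x 1 * q)"])
       (simp_all add: pm_linear_lin_ext_comp pm_linear_mult_left pm_linear_id mult_single assms)
qed (simp_all add: lin_ext_add lin_ext_scale distrib_right scale_pm_mult_left)

lemmas pm_lin_intros = pm_linear_id pm_linear_sum_fun pm_linear_scale_fun
  pm_linear_mult_left pm_linear_mult_right pm_linear_lin_ext_comp pm_linear_lin_ext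

text \<open>A concrete tensor product: pairs of basis elements form a basis, so identities between
  such tensors are plain equalities, in contrast to \<open>tensor2_eq\<close>.\<close>

definition tens :: "('x \<Rightarrow>\<^sub>0 'k::field) \<Rightarrow> ('y \<Rightarrow>\<^sub>0 'k) \<Rightarrow> ('x \<times> 'y \<Rightarrow>\<^sub>0 'k)" where
  "tens p q = lin_ext (\<lambda>x. lin_ext (\<lambda>y. Poly_Mapping.single (x, y) 1) q) p"

lemma pm_linear_tens_left: "pm_linear f \<Longrightarrow> pm_linear (\<lambda>p. tens (f p) q)"
  unfolding tens_def by (rule pm_linear_lin_ext_comp)

lemma pm_linear_tens_right: "pm_linear f \<Longrightarrow> pm_linear (\<lambda>q. tens p (f q))"
  unfolding tens_def by (intro pm_linear_lin_ext_fun pm_linear_lin_ext_comp)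

lemma tens_single [simp]:
  "tens (Poly_Mapping.single x c) (Poly_Mapping.single y d) = Poly_Mapping.single (x, y) (c * d)"
  by (simp add: tens_def)

lemma tens_single_one [simp]:
  "tens (Poly_Mapping.single x c) 1 = Poly_Mapping.single (x, 0) c"
  "tens 1 (Poly_Mapping.single y c) = Poly_Mapping.single (0, y) c"
  by (simp_all add: tens_def)

lemmas tens_add_left = pm_linear_add[OF pm_linear_tens_left[OF pm_linear_id]]
lemmas tens_add_right = pm_linear_add[OF pm_linear_tens_right[OF pm_linear_id]]
lemmas tens_scale_left = pm_linear_scale[OF pm_linear_tens_left[OF pm_linear_id]]
lemmas tens_scale_right = pm_linear_scale[OF pm_linear_tens_right[OF pm_linear_id]]
lemmas tens_zero_left [simp] = pm_linear_0[OF pm_linear_tens_left[OF pm_linear_id]]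
lemmas tens_zero_right [simp] = pm_linear_0[OF pm_linear_tens_right[OF pm_linear_id]]

lemma tens_mult:
  fixes p p' :: "'x::monoid_add \<Rightarrow>\<^sub>0 'k::field" and q q' :: "'y::monoid_add \<Rightarrow>\<^sub>0 'k"
  shows "tens (p * p') (q * q') = tens p q * tens p' q'"
proof (induction p rule: pm_induct)
  case (basis x) show ?case
  proof (induction p' rule: pm_induct)
    case (basis x') show ?case
    proof (induction q rule: pm_induct)
      case (basis y) show ?case
        by (induction q' rule: pm_induct)
           (simp_all add: distrib_left distrib_right tens_add_right tens_scale_right
              scale_pm_mult_left scale_pm_mult_right mult_single)
    qed (simp_all add: distrib_left distrib_right tens_add_right tens_scale_right
              scale_pm_mult_left scale_pm_mult_right)
  qed (simp_all add: distrib_left distrib_right tens_add_left tens_scale_left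
              scale_pm_mult_left scale_pm_mult_right)
qed (simp_all add: distrib_left distrib_right tens_add_left tens_scale_left
              scale_pm_mult_left scale_pm_mult_right)

lemma lin_ext_tens:
  "lin_ext f (tens p q) = lin_ext (\<lambda>x. lin_ext (\<lambda>y. f (x, y)) q) p"
  by (simp add: tens_def lin_ext_lin_ext)

text \<open>The left-hand side is the linear map on the tensor product that the bilinear map
  \<open>B\<close> induces.\<close>

lemma lin_ext_bilinear:
  assumes "\<And>q. pm_linear (\<lambda>p. B p q)" "\<And>p. pm_linear (\<lambda>q. B p q)"
  shows "lin_ext (\<lambda>(m, n). B (Poly_Mapping.single m 1) (Poly_Mapping.single n 1)) (tens p q) = B p q"
proof -
  have "lin_ext (\<lambda>(m, n). B (Poly_Mapping.single m 1) (Poly_Mapping.single n 1)) (tens p q)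
    = lin_ext (\<lambda>m. lin_ext (\<lambda>n. B (Poly_Mapping.single m 1) (Poly_Mapping.single n 1)) q) p"
    by (simp add: lin_ext_tens)
  also have "\<dots> = B p q"
    by (simp add: lin_ext_basis[OF assms(2)] lin_ext_basis[OF assms(1)])
  finally show ?thesis .
qed

section \<open>The product on the symmetric algebra\<close>

definition mdeg :: "('n::finite \<Rightarrow>\<^sub>0 nat) \<Rightarrow> nat" where
  "mdeg m = (\<Sum>i\<in>UNIV. Poly_Mapping.lookup m i)"

lemma mdeg_add [simp]: "mdeg (m + n) = mdeg m + mdeg n"
  by (simp add: mdeg_def lookup_add sum.distrib)

lemma mdeg_zero [simp]: "mdeg 0 = 0"
  by (simp add: mdeg_def)

lemma mdeg_single [simp]: "mdeg (Poly_Mapping.single i c) = c"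
  by (simp add: mdeg_def lookup_single when_def)

lemma mdeg_eq_0_iff: "mdeg m = 0 \<longleftrightarrow> m = 0"
  by (auto simp: mdeg_def poly_mapping_eq_iff fun_eq_iff)

lemma monomial_diff_cancel:
  "Poly_Mapping.lookup m i > 0 \<Longrightarrow> m - Poly_Mapping.single i 1 + Poly_Mapping.single i (1::nat) = m"
  by (rule poly_mapping_eqI) (auto simp: lookup_add lookup_minus lookup_single when_def)

lemma monomial_induct [case_names zero add]:
  fixes m :: "'n::finite \<Rightarrow>\<^sub>0 nat"
  assumes "P 0" "\<And>m i. P m \<Longrightarrow> P (m + Poly_Mapping.single i 1)"
  shows "P m"
proof (induction "mdeg m" arbitrary: m)
  case 0
  then show ?case using assms(1) by (simp add: mdeg_eq_0_iff)
next
  case (Suc k)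
  then obtain i where i: "Poly_Mapping.lookup m i > 0"
    by (metis gr0I lookup_zero mdeg_eq_0_iff nat.distinct(1) poly_mapping_eqI)
  define n where "n = m - Poly_Mapping.single i 1"
  have m: "m = n + Poly_Mapping.single i 1"
    using monomial_diff_cancel[OF i] by (simp add: n_def)
  then show ?case using Suc assms(2)[of n i] by simp
qed

text \<open>The derivation D. Where the index \<open>i\<close> does not occur in \<open>m\<close>,
  the truncated subtraction yields a meaningless monomial, but its coefficient is 0.\<close>

definition shift_deriv :: "'k::field ^ 'n::finite \<Rightarrow> ('n, 'k) sym \<Rightarrow> ('n, 'k) sym" where
  "shift_deriv a = lin_ext (\<lambda>m. \<Sum>i\<in>UNIV.
    Poly_Mapping.single (m - Poly_Mapping.single i 1) (a $ i * of_nat (Poly_Mapping.lookup m i)))"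

lemma pm_linear_shift_deriv [simp]: "pm_linear (shift_deriv a)"
  by (simp add: shift_deriv_def)

lemma monomial_diff_add:
  "Poly_Mapping.lookup m i > 0 \<Longrightarrow>
    m - Poly_Mapping.single i 1 + n = m + n - Poly_Mapping.single i (1::nat)"
  by (rule poly_mapping_eqI) (auto simp: lookup_add lookup_minus lookup_single when_def)

lemma shift_deriv_mult: "shift_deriv a (p * q) = shift_deriv a p * q + p * shift_deriv a q"
proof (induction p rule: pm_induct)
  case (basis m)
  show ?case
  proof (induction q rule: pm_induct)
    case (basis n)
    \<comment> \<open>The Leibniz rule for a single partial derivative. Whether \<open>i\<close>
      occurs in \<open>m\<close> and in \<open>n\<close> has to be distinguished because subtraction
      of exponents is truncated.\<close>
    have "Poly_Mapping.single (m + n - Poly_Mapping.single i 1)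
          (a $ i * of_nat (Poly_Mapping.lookup (m + n) i)) =
        Poly_Mapping.single (m - Poly_Mapping.single i 1 + n) (a $ i * of_nat (Poly_Mapping.lookup m i))
        + Poly_Mapping.single (n - Poly_Mapping.single i 1 + m) (a $ i * of_nat (Poly_Mapping.lookup n i))" for i
      by (cases "Poly_Mapping.lookup m i > 0"; cases "Poly_Mapping.lookup n i > 0")
         (simp_all add: monomial_diff_add add.commute[of n m] lookup_add distrib_left single_add del: One_nat_def)
    then show ?case
      by (simp add: shift_deriv_def mult_single sum_distrib_left sum_distrib_right
          add.commute[of m] flip: sum.distrib)
  qed (simp_all add: pm_linear_0 pm_linear_add pm_linear_scale
        scale_pm_mult_left scale_pm_mult_right algebra_simps pm.scale_right_distrib)
qed (simp_all add: pm_linear_0 pm_linear_add pm_linear_scale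
        scale_pm_mult_left scale_pm_mult_right algebra_simps pm.scale_right_distrib)

lemma shift_deriv_gen: "shift_deriv a (sym_gen i) = Poly_Mapping.single 0 (a $ i)"
proof -
  have "shift_deriv a (sym_gen i) = (\<Sum>j\<in>UNIV. if j = i then Poly_Mapping.single 0 (a $ i) else 0)"
    unfolding shift_deriv_def sym_gen_def lin_ext_single pm.scale_one
    by (rule sum.cong) (simp_all add: lookup_single when_def)
  then show ?thesis by simp
qed

definition shift :: "'k::field ^ 'n::finite \<Rightarrow> ('n, 'k) sym \<Rightarrow> ('n, 'k) sym" where
  "shift a p = p + shift_deriv a p"

lemma pm_linear_shift [simp]: "pm_linear (shift a)"
  unfolding shift_def by (intro pm_lin_intros pm_linear_shift_deriv)

lemma pm_linear_shift_funpow [simp]: "pm_linear (shift a ^^ k)"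
  by (induction k) (simp_all add: id_def pm_linear_id comp_def pm_linear_comp)

lemma shift_gen_mult: "shift a (sym_gen i * w) = sym_gen i * shift a w + scale_pm (a $ i) w"
  by (simp add: shift_def shift_deriv_mult shift_deriv_gen scale_pm_conv_mult algebra_simps)

text \<open>The commutator of \<open>shift a\<close> with multiplication by \<open>sym_gen i\<close>
  is the scalar \<open>a $ i\<close>, which commutes with \<open>shift a\<close>, so each of the k
  factors contributes one such term. For k = 0 the truncated exponent is harmless, as its
  coefficient vanishes.\<close>

lemma shift_funpow_gen_mult:
  "(shift a ^^ k) (sym_gen i * w) =
    sym_gen i * (shift a ^^ k) w + scale_pm (of_nat k * a $ i) ((shift a ^^ (k - 1)) w)"
proof (induction k)
  case (Suc k)
  have "(shift a ^^ Suc k) (sym_gen i * w) = sym_gen i * (shift a ^^ Suc k) w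
      + (scale_pm (a $ i) ((shift a ^^ k) w) + scale_pm (of_nat k * a $ i) (shift a ((shift a ^^ (k - 1)) w)))"
    by (simp add: Suc.IH pm_linear_add pm_linear_scale shift_gen_mult)
  also have "scale_pm (of_nat k * a $ i) (shift a ((shift a ^^ (k - 1)) w))
      = scale_pm (of_nat k * a $ i) ((shift a ^^ k) w)"
    by (cases k) simp_all
  finally show ?case by (simp add: distrib_right pm.scale_left_distrib)
qed simp

definition black_prod :: "'k::field ^ 'n::finite \<Rightarrow> ('n, 'k) sym \<Rightarrow> ('n, 'k) sym \<Rightarrow> ('n, 'k) sym" where
  "black_prod a p q = lin_ext (\<lambda>m. Poly_Mapping.single m 1 * (shift a ^^ mdeg m) q) p"

lemma pm_linear_black_prod_left: "pm_linear f \<Longrightarrow> pm_linear (\<lambda>p. black_prod a (f p) q)"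
  unfolding black_prod_def by (rule pm_linear_lin_ext_comp)

lemma pm_linear_black_prod_right: "pm_linear f \<Longrightarrow> pm_linear (\<lambda>q. black_prod a p (f q))"
  unfolding black_prod_def
  by (intro pm_linear_lin_ext_fun pm_linear_mult_left pm_linear_comp[OF pm_linear_shift_funpow])

lemmas black_prod_add_left = pm_linear_add[OF pm_linear_black_prod_left[OF pm_linear_id]]
lemmas black_prod_add_right = pm_linear_add[OF pm_linear_black_prod_right[OF pm_linear_id]]
lemmas black_prod_scale_left = pm_linear_scale[OF pm_linear_black_prod_left[OF pm_linear_id]]
lemmas black_prod_scale_right = pm_linear_scale[OF pm_linear_black_prod_right[OF pm_linear_id]]
lemmas black_prod_zero_left [simp] = pm_linear_0[OF pm_linear_black_prod_left[OF pm_linear_id]]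
lemmas black_prod_zero_right [simp] = pm_linear_0[OF pm_linear_black_prod_right[OF pm_linear_id]]
lemmas black_prod_sum_right = pm_linear_sum[OF pm_linear_black_prod_right[OF pm_linear_id]]
lemmas black_prod_diff_left = pm_linear_diff[OF pm_linear_black_prod_left[OF pm_linear_id]]

lemma black_prod_monomial: "black_prod a (Poly_Mapping.single m 1) q = Poly_Mapping.single m 1 * (shift a ^^ mdeg m) q"
  by (simp add: black_prod_def)

lemma black_prod_one_left [simp]: "black_prod a 1 q = q"
  using black_prod_monomial[of a 0 q] by simp

lemma shift_one [simp]: "shift a 1 = 1"
  by (simp add: shift_def shift_deriv_def flip: single_one)

lemma shift_funpow_one [simp]: "(shift a ^^ k) 1 = 1"
  by (induction k) simp_all

lemma black_prod_one_right [simp]: "black_prod a p 1 = p"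
  by (simp add: black_prod_def)

lemma black_prod_monomial_gen:
  "black_prod a (Poly_Mapping.single m 1) (sym_gen i)
    = Poly_Mapping.single (m + Poly_Mapping.single i 1) 1 + Poly_Mapping.single m (of_nat (mdeg m) * a $ i)"
  using shift_funpow_gen_mult[of "mdeg m" a i 1]
  by (simp add: black_prod_monomial distrib_left scale_pm_mult_right) (simp add: sym_gen_def mult_single)

text \<open>Degrees add up under multiplication by \<open>m\<close>, so the exponent of
  \<open>shift a\<close> splits and the part that belongs to \<open>m\<close> can be applied to
  \<open>q\<close> beforehand.\<close>

lemma black_prod_monomial_mult:
  fixes a :: "'k::field ^ 'n::finite"
  shows "black_prod a (Poly_Mapping.single m 1 * p) q = Poly_Mapping.single m 1 * black_prod a p ((shift a ^^ mdeg m) q)"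
proof (rule pm_linear_eq[where p = p])
  fix n :: "'n \<Rightarrow>\<^sub>0 nat"
  have "(shift a ^^ mdeg n) ((shift a ^^ mdeg m) q) = (shift a ^^ (mdeg n + mdeg m)) q"
    by (simp add: funpow_add)
  then show "black_prod a (Poly_Mapping.single m 1 * Poly_Mapping.single n 1) q
      = Poly_Mapping.single m 1 * black_prod a (Poly_Mapping.single n 1) ((shift a ^^ mdeg m) q)"
    by (simp add: black_prod_monomial mult_single add.commute flip: mult.assoc)
qed (intro pm_linear_black_prod_left pm_lin_intros)+

text \<open>For a monomial m of degree k, every term of D m has degree k - 1, so D m \<triangleleft>
  T q = (D m) \<open>T\<^sup>k\<^sup>-\<^sup>1\<close> T q = (D m) \<open>T\<^sup>k\<close> q. This
  is exactly the term that the Leibniz rule for D (m \<open>T\<^sup>k\<close> q) asks for.\<close>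

lemma shift_black_prod: "shift a (black_prod a p q) = black_prod a (shift a p) (shift a q)"
proof (rule pm_linear_eq[where p = p])
  fix m
  have *: "black_prod a (shift_deriv a (Poly_Mapping.single m 1)) (shift a q)
      = shift_deriv a (Poly_Mapping.single m 1) * (shift a ^^ mdeg m) q"
  proof -
    have "scale_pm (a $ i * of_nat (Poly_Mapping.lookup m i))
          (black_prod a (Poly_Mapping.single (m - Poly_Mapping.single i 1) 1) (shift a q))
        = Poly_Mapping.single (m - Poly_Mapping.single i 1) (a $ i * of_nat (Poly_Mapping.lookup m i))
            * (shift a ^^ mdeg m) q" for i
    proof (cases "Poly_Mapping.lookup m i = 0")
      case False
      then have "mdeg m = Suc (mdeg (m - Poly_Mapping.single i 1))"
        using arg_cong[OF monomial_diff_cancel[of m i], of mdeg] by simp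
      then show ?thesis
        by (simp add: black_prod_monomial funpow_swap1 flip: scale_pm_mult_left)
    qed simp
    then show ?thesis
      by (simp add: shift_deriv_def sum_distrib_right pm_linear_sum[OF pm_linear_black_prod_left[OF pm_linear_id]]
           flip: black_prod_scale_left)
  qed
  show "shift a (black_prod a (Poly_Mapping.single m 1) q) = black_prod a (shift a (Poly_Mapping.single m 1)) (shift a q)"
    unfolding shift_def[of a "Poly_Mapping.single m 1"] black_prod_add_left *
    unfolding black_prod_monomial
    by (simp add: shift_def[of a "_ * _"] shift_deriv_mult funpow_swap1[symmetric] shift_def[of a "(shift a ^^ _) _"]
        algebra_simps)
qed (intro pm_linear_comp[OF pm_linear_shift] pm_linear_black_prod_left pm_lin_intros pm_linear_shift)+

lemma shift_funpow_black_prod: "(shift a ^^ k) (black_prod a p q) = black_prod a ((shift a ^^ k) p) ((shift a ^^ k) q)"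
  by (induction k) (simp_all add: shift_black_prod)

text \<open>For a monomial m of degree k both sides equal m times \<open>T\<^sup>k\<close> (q
  \<triangleleft> r): on the left m is pulled out and r becomes \<open>T\<^sup>k\<close> r, then
  \<open>T\<^sup>k\<close> is recombined by multiplicativity.\<close>

theorem black_prod_assoc: "black_prod a (black_prod a p q) r = black_prod a p (black_prod a q r)"
proof (rule pm_linear_eq[where p = p])
  show "black_prod a (black_prod a (Poly_Mapping.single m 1) q) r = black_prod a (Poly_Mapping.single m 1) (black_prod a q r)" for m
    by (simp add: black_prod_monomial black_prod_monomial_mult shift_funpow_black_prod)
qed (intro pm_linear_black_prod_left pm_linear_id)+

text \<open>The commutative product m \<open>\<epsilon>\<^sub>i\<close> is m \<triangleleft>
  \<open>\<epsilon>\<^sub>i\<close> minus a multiple of m, so monomials are reached by appending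
  generators for \<triangleleft>. This is the induction behind all identities that involve the
  noncommutative product.\<close>

lemma black_prod_induct [case_names zero one add scale gen]:
  assumes "P 0" "P 1" "\<And>p q. P p \<Longrightarrow> P q \<Longrightarrow> P (p + q)" "\<And>c p. P p \<Longrightarrow> P (scale_pm c p)"
    "\<And>p i. P p \<Longrightarrow> P (black_prod a p (sym_gen i))"
  shows "P p"
proof (induction p rule: pm_induct)
  case (basis m)
  show ?case
  proof (induction m rule: monomial_induct)
    case (add m i)
    have "Poly_Mapping.single (m + Poly_Mapping.single i 1) 1 = black_prod a (Poly_Mapping.single m 1) (sym_gen i)
      + scale_pm (- (of_nat (mdeg m) * a $ i)) (Poly_Mapping.single m 1)"
      by (simp add: black_prod_monomial_gen single_uminus)
    then show ?case using assms(3-5) add by metis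
  qed (simp add: assms)
qed (simp_all add: assms)

section \<open>The explicit formula, existence and uniqueness of the product\<close>

lemma prod_list_sym_gen:
  "(\<Prod>i\<leftarrow>is. sym_gen i) = Poly_Mapping.single (\<Sum>i\<leftarrow>is. Poly_Mapping.single i 1) 1"
  by (induction "is") (simp_all add: sym_gen_def mult_single)

lemma mdeg_sum_list [simp]: "mdeg (\<Sum>i\<leftarrow>is. Poly_Mapping.single i 1) = length is"
  by (induction "is") simp_all

lemma ex_monomial_list: "\<exists>is. m = (\<Sum>i\<leftarrow>is. Poly_Mapping.single (i::'n::finite) (1::nat))"
proof (induction m rule: monomial_induct)
  case zero
  show ?case by (rule exI[of _ "[]"]) simp
next
  case (add m i)
  then obtain "is" where "m = (\<Sum>i\<leftarrow>is. Poly_Mapping.single i 1)" by blast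
  then have "m + Poly_Mapping.single i 1 = (\<Sum>i\<leftarrow>i # is. Poly_Mapping.single i 1)"
    by (simp add: add.commute)
  then show ?case by blast
qed

text \<open>The letter is added at the end so that earlier positions keep their numbers. Subsets
  without the new position give the first term of \<open>shift_funpow_gen_mult\<close>; those
  containing it give the second one, in which k drops by one.\<close>

lemma shift_funpow_prod_list:
  fixes a :: "'k::field ^ 'n::finite"
  shows "(shift a ^^ k) (\<Prod>j\<leftarrow>js. sym_gen j) = (\<Sum>I\<in>Pow {..<length js}.
    scale_pm ((\<Prod>r<card I. of_nat k - of_nat r) * (\<Prod>q\<in>I. a $ (js ! q)))
      (\<Prod>p\<in>{..<length js} - I. sym_gen (js ! p)))"
proof (induction js arbitrary: k rule: rev_induct)
  case Nil
  show ?case by simp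
next
  case (snoc j js)
  let ?l = "length js"
  let ?t = "\<lambda>k js I. scale_pm ((\<Prod>r<card I. of_nat k - of_nat r) * (\<Prod>q\<in>I. a $ (js ! q)))
      (\<Prod>p\<in>{..<length js} - I. sym_gen (js ! p))"
  have A: "?t k (js @ [j]) I = sym_gen j * ?t k js I" if "I \<in> Pow {..<?l}" for I
  proof -
    have "{..<Suc ?l} - I = insert ?l ({..<?l} - I)" using that by auto
    moreover have "(\<Prod>q\<in>I. a $ ((js @ [j]) ! q)) = (\<Prod>q\<in>I. a $ (js ! q))"
      using that by (intro prod.cong) (auto simp: nth_append)
    moreover have "(\<Prod>p\<in>{..<?l} - I. sym_gen ((js @ [j]) ! p)) = (\<Prod>p\<in>{..<?l} - I. (sym_gen (js ! p) :: ('n, 'k) sym))"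
      by (intro prod.cong) (auto simp: nth_append)
    ultimately show ?thesis by (simp add: scale_pm_mult_right)
  qed
  have B: "?t k (js @ [j]) (insert ?l I) = scale_pm (of_nat k * a $ j) (?t (k - 1) js I)" if "I \<in> Pow {..<?l}" for I
  proof -
    have f: "finite I" "?l \<notin> I" using that finite_subset by auto
    have "{..<Suc ?l} - insert ?l I = {..<?l} - I" using that by auto
    moreover have "(\<Prod>q\<in>I. a $ ((js @ [j]) ! q)) = (\<Prod>q\<in>I. a $ (js ! q))"
      using that by (intro prod.cong) (auto simp: nth_append)
    moreover have "(\<Prod>p\<in>{..<?l} - I. sym_gen ((js @ [j]) ! p)) = (\<Prod>p\<in>{..<?l} - I. (sym_gen (js ! p) :: ('n, 'k) sym))"
      by (intro prod.cong) (auto simp: nth_append)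
    \<comment> \<open>The falling factorial of \<open>k\<close> splits off its first factor and
      leaves that of \<open>k - 1\<close>. For \<open>k = 0\<close> the first factor is 0, so the
      truncated subtraction does no harm.\<close>
    moreover have "(\<Prod>r<Suc (card I). of_nat k - of_nat r) = (of_nat k :: 'k) * (\<Prod>r<card I. of_nat (k - 1) - of_nat r)"
      by (cases k) (simp_all add: prod.lessThan_Suc_shift del: prod.lessThan_Suc)
    ultimately show ?thesis using f by (simp add: mult_ac del: prod.lessThan_Suc)
  qed
  have P: "Pow {..<Suc ?l} = Pow {..<?l} \<union> insert ?l ` Pow {..<?l}"
    by (simp add: lessThan_Suc Pow_insert)
  have "(shift a ^^ k) (\<Prod>j\<leftarrow>js @ [j]. sym_gen j) = (shift a ^^ k) (sym_gen j * (\<Prod>j\<leftarrow>js. sym_gen j))"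
    by (simp add: mult.commute)
  also have "\<dots> = (\<Sum>I\<in>Pow {..<?l}. ?t k (js @ [j]) I) + (\<Sum>I\<in>Pow {..<?l}. ?t k (js @ [j]) (insert ?l I))"
    unfolding shift_funpow_gen_mult snoc.IH sum_distrib_left pm.scale_sum_right
    by (intro arg_cong2[where f = "(+)"] sum.cong refl A[symmetric] B[symmetric])
  also have "(\<Sum>I\<in>Pow {..<?l}. ?t k (js @ [j]) (insert ?l I)) = (\<Sum>I\<in>insert ?l ` Pow {..<?l}. ?t k (js @ [j]) I)"
    by (subst sum.reindex) (auto intro: inj_on_inverseI[where g = "\<lambda>I. I - {?l}"])
  also have "(\<Sum>I\<in>Pow {..<?l}. ?t k (js @ [j]) I) + \<dots> = (\<Sum>I\<in>Pow {..<Suc ?l}. ?t k (js @ [j]) I)"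
    unfolding P by (rule sum.union_disjoint[symmetric]) auto
  finally show ?case by simp
qed

lemma black_product_black_prod: "black_product a (black_prod a)"
proof -
  have "black_prod a (\<Prod>i\<leftarrow>is. sym_gen i) (\<Prod>j\<leftarrow>js. sym_gen j) =
      (\<Sum>I\<in>Pow {..<length js}.
        scale_pm ((\<Prod>r<card I. of_nat (length is) - of_nat r) * (\<Prod>q\<in>I. a $ (js ! q)))
          ((\<Prod>p\<in>{..<length js} - I. sym_gen (js ! p)) * (\<Prod>i\<leftarrow>is. sym_gen i)))" for "is" js
  proof -
    have "black_prod a (\<Prod>i\<leftarrow>is. sym_gen i) (\<Prod>j\<leftarrow>js. sym_gen j)
        = (shift a ^^ length is) (\<Prod>j\<leftarrow>js. sym_gen j) * (\<Prod>i\<leftarrow>is. sym_gen i)"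
      by (simp only: prod_list_sym_gen[of "is"] black_prod_monomial mdeg_sum_list mult.commute)
    then show ?thesis
      by (simp only: shift_funpow_prod_list sum_distrib_right scale_pm_mult_left)
  qed
  then show ?thesis
    unfolding black_product_def bilinear_pm_def
    by (simp only: black_prod_add_left black_prod_add_right black_prod_scale_left black_prod_scale_right simp_thms)
qed

text \<open>Every monomial is a product of generators, so the formula prescribes the bilinear map on
  all pairs of basis elements.\<close>

lemma black_product_unique:
  assumes "black_product a f"
  shows "f = black_prod a"
proof (intro ext)
  fix p q
  have lin: "pm_linear (\<lambda>p. f p q)" "pm_linear (f p)" for p q
    using assms by (auto intro!: pm_linearI simp: black_product_def bilinear_pm_def)
  have basis: "f (Poly_Mapping.single m 1) (Poly_Mapping.single n 1)
      = black_prod a (Poly_Mapping.single m 1) (Poly_Mapping.single n 1)" for m n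
  proof -
    obtain "is" js where "m = (\<Sum>i\<leftarrow>is. Poly_Mapping.single i 1)" "n = (\<Sum>i\<leftarrow>js. Poly_Mapping.single i 1)"
      using ex_monomial_list by metis
    moreover have "f (\<Prod>i\<leftarrow>is. sym_gen i) (\<Prod>j\<leftarrow>js. sym_gen j)
        = black_prod a (\<Prod>i\<leftarrow>is. sym_gen i) (\<Prod>j\<leftarrow>js. sym_gen j)"
      using assms black_product_black_prod[of a] unfolding black_product_def by (elim conjE) (simp only:)
    ultimately show ?thesis by (simp only: prod_list_sym_gen)
  qed
  have "f (Poly_Mapping.single m 1) q = black_prod a (Poly_Mapping.single m 1) q" for m
    by (rule pm_linear_eq[OF lin(2) pm_linear_black_prod_right[OF pm_linear_id] basis])
  then show "f p q = black_prod a p q"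
    by (rule pm_linear_eq[OF lin(1) pm_linear_black_prod_left[OF pm_linear_id]])
qed

text \<open>Makes the counit multiplicative. A product ending in a generator has no constant term:
  in m \<triangleleft> \<open>\<epsilon>\<^sub>i\<close> the monomial m reappears with a coefficient
  proportional to its degree, which is 0 for m = 1.\<close>

lemma lookup_black_prod_zero:
  "Poly_Mapping.lookup (black_prod a p q) 0 = Poly_Mapping.lookup p 0 * Poly_Mapping.lookup q 0"
proof (induction q rule: black_prod_induct[of _ a])
  case (gen q i)
  have "Poly_Mapping.lookup (black_prod a p (sym_gen i)) 0 = 0" for p
  proof (induction p rule: pm_induct)
    case (basis m)
    have "m + Poly_Mapping.single i 1 \<noteq> 0"
      by (metis add_is_0 mdeg_add mdeg_eq_0_iff mdeg_single one_neq_zero)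
    then show ?case by (auto simp: black_prod_monomial_gen lookup_add lookup_single when_def)
  qed (simp_all add: black_prod_add_left black_prod_scale_left lookup_add)
  then show ?case by (simp flip: black_prod_assoc)
qed (simp_all add: black_prod_add_right black_prod_scale_right lookup_add algebra_simps)

section \<open>The coproduct\<close>

declare One_nat_def [simp del]

lemma sym_comult_monomial_add:
  fixes x :: "'n::finite \<Rightarrow> 'b::comm_monoid_mult"
  shows "(\<Prod>i\<in>UNIV. x i ^ Poly_Mapping.lookup (m + n) i) =
    (\<Prod>i\<in>UNIV. x i ^ Poly_Mapping.lookup m i) * (\<Prod>i\<in>UNIV. x i ^ Poly_Mapping.lookup n i)"
  by (simp add: lookup_add power_add prod.distrib)

lemma pm_linear_sym_comult [simp]: "pm_linear sym_comult_alg"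
  by (simp add: sym_comult_alg_def)

lemma sym_comult_mult: "sym_comult_alg (p * q) = sym_comult_alg p * sym_comult_alg q"
  unfolding sym_comult_alg_def by (rule lin_ext_mult) (rule sym_comult_monomial_add)

lemma sym_comult_monomial:
  "sym_comult_alg (Poly_Mapping.single (m + n) 1 :: ('n::finite, 'k::field) sym)
    = sym_comult_alg (Poly_Mapping.single m 1) * sym_comult_alg (Poly_Mapping.single n 1)"
  by (simp add: mult_single flip: sym_comult_mult)

lemma sym_comult_one [simp]: "sym_comult_alg 1 = 1"
  by (simp add: sym_comult_alg_def)

lemma sym_comult_gen: "sym_comult_alg (sym_gen i) = tens (sym_gen i) 1 + tens 1 (sym_gen i)"
proof -
  have "(\<Prod>j\<in>UNIV. x j ^ Poly_Mapping.lookup (Poly_Mapping.single i 1) j) = x i" for x :: "'a \<Rightarrow> 'c::comm_monoid_mult"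
  proof -
    have "(\<Prod>j\<in>UNIV. x j ^ Poly_Mapping.lookup (Poly_Mapping.single i 1) j) = (\<Prod>j\<in>UNIV. if j = i then x j else 1)"
      by (rule prod.cong) (simp_all add: lookup_single when_def)
    then show ?thesis by simp
  qed
  then show ?thesis
    by (simp add: sym_comult_alg_def sym_gen_def tens_def flip: single_one)
qed

text \<open>The multiplication of the type is the tensor square of the commutative product; this is
  the tensor square of \<triangleleft>, the one for which the bialgebra axiom is stated.\<close>

definition black_prod2 ::
  "'k::field ^ 'n::finite \<Rightarrow> (('n \<Rightarrow>\<^sub>0 nat) \<times> ('n \<Rightarrow>\<^sub>0 nat) \<Rightarrow>\<^sub>0 'k) \<Rightarrow> _ \<Rightarrow> (('n \<Rightarrow>\<^sub>0 nat) \<times> ('n \<Rightarrow>\<^sub>0 nat) \<Rightarrow>\<^sub>0 'k)" where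
  "black_prod2 a p q = lin_ext (\<lambda>x. lin_ext (\<lambda>y.
    tens (black_prod a (Poly_Mapping.single (fst x) 1) (Poly_Mapping.single (fst y) 1))
      (black_prod a (Poly_Mapping.single (snd x) 1) (Poly_Mapping.single (snd y) 1))) q) p"

lemma pm_linear_black_prod2_left: "pm_linear f \<Longrightarrow> pm_linear (\<lambda>p. black_prod2 a (f p) q)"
  unfolding black_prod2_def by (rule pm_linear_lin_ext_comp)

lemma pm_linear_black_prod2_right: "pm_linear f \<Longrightarrow> pm_linear (\<lambda>q. black_prod2 a p (f q))"
  unfolding black_prod2_def by (intro pm_linear_lin_ext_fun pm_linear_lin_ext_comp)

lemmas black_prod2_add_left = pm_linear_add[OF pm_linear_black_prod2_left[OF pm_linear_id]]
lemmas black_prod2_add_right = pm_linear_add[OF pm_linear_black_prod2_right[OF pm_linear_id]]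
lemmas black_prod2_scale_left = pm_linear_scale[OF pm_linear_black_prod2_left[OF pm_linear_id]]
lemmas black_prod2_scale_right = pm_linear_scale[OF pm_linear_black_prod2_right[OF pm_linear_id]]
lemmas black_prod2_zero_left [simp] = pm_linear_0[OF pm_linear_black_prod2_left[OF pm_linear_id]]
lemmas black_prod2_zero_right [simp] = pm_linear_0[OF pm_linear_black_prod2_right[OF pm_linear_id]]

lemmas black_prod_lin_intros = pm_lin_intros pm_linear_tens_left pm_linear_tens_right
  pm_linear_black_prod_left pm_linear_black_prod_right pm_linear_black_prod2_left pm_linear_black_prod2_right

lemma tens_induct [case_names zero tens add]:
  assumes "P 0" "\<And>x y. P (tens x y)" "\<And>p q. P p \<Longrightarrow> P q \<Longrightarrow> P (p + q)"
  shows "P p"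
proof -
  have "P (\<Sum>x\<in>A. tens (Poly_Mapping.single (fst x) (Poly_Mapping.lookup p x)) (Poly_Mapping.single (snd x) 1))" if "finite A" for A
    using that by (induction A) (simp_all add: assms del: tens_single)
  from this[of "Poly_Mapping.keys p"] show ?thesis using pm_as_sum[of p] by simp
qed

lemma black_prod2_tens: "black_prod2 a (tens p q) (tens p' q') = tens (black_prod a p p') (black_prod a q q')"
proof -
  have "black_prod2 a (tens p q) (tens p' q') = lin_ext (\<lambda>x. lin_ext (\<lambda>y. lin_ext (\<lambda>x'. lin_ext (\<lambda>y'.
       tens (black_prod a (Poly_Mapping.single x 1) (Poly_Mapping.single x' 1)) (black_prod a (Poly_Mapping.single y 1) (Poly_Mapping.single y' 1))) q') p') q) p"
    by (simp add: black_prod2_def lin_ext_tens)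
  also have "\<dots> = lin_ext (\<lambda>x. lin_ext (\<lambda>y. lin_ext (\<lambda>x'. 
       tens (black_prod a (Poly_Mapping.single x 1) (Poly_Mapping.single x' 1)) (black_prod a (Poly_Mapping.single y 1) q')) p') q) p"
    by (subst lin_ext_basis[of "\<lambda>q'. tens _ (black_prod a _ q')"]) (intro black_prod_lin_intros refl)+
  also have "\<dots> = lin_ext (\<lambda>x. lin_ext (\<lambda>y. 
       tens (black_prod a (Poly_Mapping.single x 1) p') (black_prod a (Poly_Mapping.single y 1) q')) q) p"
    by (subst lin_ext_basis[of "\<lambda>p'. tens (black_prod a _ p') _"]) (intro black_prod_lin_intros refl)+
  also have "\<dots> = lin_ext (\<lambda>x. tens (black_prod a (Poly_Mapping.single x 1) p') (black_prod a q q')) p"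
    by (subst lin_ext_basis[of "\<lambda>q. tens _ (black_prod a q _)"]) (intro black_prod_lin_intros refl)+
  also have "\<dots> = tens (black_prod a p p') (black_prod a q q')"
    by (rule lin_ext_basis[of "\<lambda>p. tens (black_prod a p _) _"]) (intro black_prod_lin_intros)
  finally show ?thesis .
qed

lemma tens_one_one [simp]: "tens 1 1 = (1 :: 'x::monoid_add \<times> 'y::monoid_add \<Rightarrow>\<^sub>0 'k::field)"
  by (simp add: zero_prod_def flip: single_one)

lemma black_prod2_assoc: "black_prod2 a (black_prod2 a p q) r = black_prod2 a p (black_prod2 a q r)"
proof (induction p rule: tens_induct)
  case (tens x y) show ?case
  proof (induction q rule: tens_induct)
    case (tens x' y') show ?case
      by (induction r rule: tens_induct) (simp_all add: black_prod2_tens black_prod_assoc black_prod2_add_right)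
  qed (simp_all add: black_prod2_add_left black_prod2_add_right)
qed (simp_all add: black_prod2_add_left)

lemma black_prod2_one_right: "black_prod2 a p 1 = p"
  by (induction p rule: tens_induct) (simp_all add: black_prod2_tens black_prod2_add_left flip: tens_one_one)

lemma pm_linear_eq_on_keys:
  assumes "pm_linear f" "pm_linear g"
    "\<And>x. x \<in> Poly_Mapping.keys p \<Longrightarrow> f (Poly_Mapping.single x 1) = g (Poly_Mapping.single x 1)"
  shows "f p = g p"
proof -
  have "h p = (\<Sum>x\<in>Poly_Mapping.keys p. scale_pm (Poly_Mapping.lookup p x) (h (Poly_Mapping.single x 1)))"
    if "pm_linear h" for h
    using lin_ext_basis[OF that, of p] unfolding lin_ext_def by simp
  from this[OF assms(1)] this[OF assms(2)] show ?thesis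
    using assms(3) by (metis (no_types, lifting) sum.cong)
qed

text \<open>The coproduct is homogeneous for the total degree: each generator goes into exactly one
  of the two slots.\<close>

lemma keys_sym_comult_monomial:
  "x \<in> Poly_Mapping.keys (sym_comult_alg (Poly_Mapping.single m 1 :: ('n::finite, 'k::field) sym))
    \<Longrightarrow> mdeg (fst x) + mdeg (snd x) = mdeg m"
proof (induction m arbitrary: x rule: monomial_induct)
  case zero
  then show ?case by simp
next
  case (add m i)
  have "Poly_Mapping.keys (sym_comult_alg (sym_gen i) :: (('n \<Rightarrow>\<^sub>0 nat) \<times> ('n \<Rightarrow>\<^sub>0 nat) \<Rightarrow>\<^sub>0 'k))
      \<subseteq> {(Poly_Mapping.single i 1, 0), (0, Poly_Mapping.single i 1)}"
    using keys_add[of "Poly_Mapping.single (Poly_Mapping.single i 1, 0) (1::'k)" "Poly_Mapping.single (0, Poly_Mapping.single i 1) 1"]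
    unfolding sym_comult_gen by (simp add: sym_gen_def insert_commute)
  moreover have "sym_comult_alg (Poly_Mapping.single (m + Poly_Mapping.single i 1) 1 :: ('n, 'k) sym)
      = sym_comult_alg (Poly_Mapping.single m 1) * sym_comult_alg (sym_gen i)"
    by (simp add: sym_gen_def mult_single flip: sym_comult_mult)
  ultimately obtain y z where yz: "x = y + z" "y \<in> Poly_Mapping.keys (sym_comult_alg (Poly_Mapping.single m 1 :: ('n, 'k) sym))"
      "z \<in> {(Poly_Mapping.single i 1, 0), (0, Poly_Mapping.single i 1)}"
    using add.prems keys_mult[of "sym_comult_alg (Poly_Mapping.single m 1 :: ('n, 'k) sym)" "sym_comult_alg (sym_gen i)"]
    by (smt (verit, ccfv_threshold) mem_Collect_eq subset_eq)
  then show ?case using add.IH[OF yz(2)] by auto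
qed

text \<open>Multiplying x \<otimes> y by the primitive element \<open>\<epsilon>\<^sub>i\<close> for
  \<triangleleft> differs from the commutative product by (deg x + deg y) \<open>a\<^sub>i\<close>
  times x \<otimes> y. For the terms of the coproduct of a monomial m, the sum of degrees is deg m,
  so the correction is the same as for m itself.\<close>

lemma sym_comult_black_prod_gen: "sym_comult_alg (black_prod a p (sym_gen i)) = black_prod2 a (sym_comult_alg p) (sym_comult_alg (sym_gen i))"
proof (rule pm_linear_eq[where p = p])
  fix m
  let ?s = "\<lambda>m. Poly_Mapping.single m (1::'b)"
  have "black_prod2 a (sym_comult_alg (?s m)) (sym_comult_alg (sym_gen i))
     = sym_comult_alg (?s m) * sym_comult_alg (sym_gen i)
        + scale_pm (of_nat (mdeg m) * a $ i) (sym_comult_alg (?s m))"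
  \<comment> \<open>Only terms that occur in the coproduct are compared, because the scalar on the
    right is correct only for total degree \<open>mdeg m\<close>.\<close>
  proof (rule pm_linear_eq_on_keys[where p = "sym_comult_alg (?s m)"])
    fix x assume x: "x \<in> Poly_Mapping.keys (sym_comult_alg (?s m))"
    have s: "Poly_Mapping.single x 1 = tens (?s (fst x)) (?s (snd x))" by simp
    have t: "black_prod a (?s n) (sym_gen i) = ?s n * sym_gen i + scale_pm (of_nat (mdeg n) * a $ i) (?s n)" for n
      unfolding black_prod_monomial_gen by (simp add: sym_gen_def mult_single)
    have "black_prod2 a (tens (?s (fst x)) (?s (snd x))) (sym_comult_alg (sym_gen i))
      = tens (?s (fst x)) (?s (snd x)) * sym_comult_alg (sym_gen i)
        + scale_pm (of_nat (mdeg (fst x) + mdeg (snd x)) * a $ i) (tens (?s (fst x)) (?s (snd x)))"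
      unfolding sym_comult_gen black_prod2_add_right black_prod2_tens t black_prod_one_right tens_add_left tens_add_right
        tens_scale_left tens_scale_right distrib_left of_nat_add distrib_right pm.scale_left_distrib
        tens_mult[symmetric]
      by (simp only: mult_1_right mult_1_left ac_simps)
    then show "black_prod2 a (Poly_Mapping.single x 1) (sym_comult_alg (sym_gen i))
      = Poly_Mapping.single x 1 * sym_comult_alg (sym_gen i)
        + scale_pm (of_nat (mdeg m) * a $ i) (Poly_Mapping.single x 1)"
      unfolding s keys_sym_comult_monomial[OF x] .
  qed (intro black_prod_lin_intros)+
  then show "sym_comult_alg (black_prod a (?s m) (sym_gen i)) = black_prod2 a (sym_comult_alg (?s m)) (sym_comult_alg (sym_gen i))"
    by (simp add: black_prod_monomial_gen pm_linear_add flip: sym_comult_mult)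
       (simp add: sym_gen_def mult_single flip: pm_linear_scale[OF pm_linear_sym_comult])
qed (intro pm_linear_comp[OF pm_linear_sym_comult] black_prod_lin_intros pm_linear_sym_comult)+

lemma sym_comult_black_prod: "sym_comult_alg (black_prod a p q) = black_prod2 a (sym_comult_alg p) (sym_comult_alg q)"
  by (induction q rule: black_prod_induct[of _ a])
     (simp_all add: pm_linear_0 pm_linear_add pm_linear_scale black_prod2_one_right black_prod_add_right black_prod2_add_right
        black_prod_scale_right black_prod2_scale_right sym_comult_black_prod_gen black_prod2_assoc flip: black_prod_assoc)

text \<open>Coassociativity and the counit laws do not involve \<triangleleft>. They are identities
  between morphisms of commutative algebras and are therefore checked on generators.\<close>

lemma sym_alg_hom_eq:
  fixes f g :: "('n::finite, 'k::field) sym \<Rightarrow> ('x::comm_monoid_add \<Rightarrow>\<^sub>0 'k)"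
  assumes lin: "pm_linear f" "pm_linear g" and one: "f 1 = g 1"
    and mult: "\<And>p q. f (p * q) = f p * f q" "\<And>p q. g (p * q) = g p * g q"
    and gen: "\<And>i. f (sym_gen i) = g (sym_gen i)"
  shows "f p = g p"
proof (rule pm_linear_eq[OF lin])
  fix m
  show "f (Poly_Mapping.single m 1) = g (Poly_Mapping.single m 1)"
  proof (induction m rule: monomial_induct)
    case (add m i)
    have "Poly_Mapping.single (m + Poly_Mapping.single i 1) 1 = Poly_Mapping.single m (1::'k) * sym_gen i"
      by (simp add: sym_gen_def mult_single)
    then show ?case by (simp only: mult gen add)
  qed (simp add: one)
qed

lemma sym_comult_coassoc:
  fixes p :: "('n::finite, 'k::field) sym"
  shows "lin_ext (\<lambda>(m, n). lin_ext (\<lambda>(u, v). Poly_Mapping.single (u, v, n) 1) (sym_comult_alg (Poly_Mapping.single m 1))) (sym_comult_alg p)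
    = lin_ext (\<lambda>(m, n). lin_ext (\<lambda>(u, v). Poly_Mapping.single (m, u, v) 1) (sym_comult_alg (Poly_Mapping.single n 1))) (sym_comult_alg p)"
    (is "lin_ext ?l _ = lin_ext ?r _")
proof (rule sym_alg_hom_eq[where p = p])
  \<comment> \<open>Attaching a third slot is compatible with products in all three slots; together
    with the multiplicativity of the coproduct this makes \<open>?l\<close>, the map \<Delta>
    \<otimes> id, multiplicative on pairs of monomials. The map \<open>?r\<close> is id \<otimes>
    \<Delta>.\<close>
  have "lin_ext (\<lambda>(u, v). Poly_Mapping.single (u, v, n + n') (1::'k)) (P * Q)
     = lin_ext (\<lambda>(u, v). Poly_Mapping.single (u, v, n) 1) P * lin_ext (\<lambda>(u, v). Poly_Mapping.single (u, v, n') 1) Q"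
    for n n' :: "'n \<Rightarrow>\<^sub>0 nat" and P Q :: "('n \<Rightarrow>\<^sub>0 nat) \<times> ('n \<Rightarrow>\<^sub>0 nat) \<Rightarrow>\<^sub>0 'k"
  proof (induction P rule: pm_induct)
    case (basis x) show ?case
      by (induction Q rule: pm_induct)
         (simp_all add: lin_ext_add lin_ext_scale mult_single distrib_left scale_pm_mult_right
            case_prod_unfold)
  qed (simp_all add: lin_ext_add lin_ext_scale distrib_right scale_pm_mult_left)
  then have l: "?l (x + y) = ?l x * ?l y" for x y
    by (simp add: case_prod_unfold sym_comult_monomial)
  have "lin_ext (\<lambda>(u, v). Poly_Mapping.single (m + m', u, v) (1::'k)) (P * Q)
     = lin_ext (\<lambda>(u, v). Poly_Mapping.single (m, u, v) 1) P * lin_ext (\<lambda>(u, v). Poly_Mapping.single (m', u, v) 1) Q"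
    for m m' :: "'n \<Rightarrow>\<^sub>0 nat" and P Q :: "('n \<Rightarrow>\<^sub>0 nat) \<times> ('n \<Rightarrow>\<^sub>0 nat) \<Rightarrow>\<^sub>0 'k"
  proof (induction P rule: pm_induct)
    case (basis x) show ?case
      by (induction Q rule: pm_induct)
         (simp_all add: lin_ext_add lin_ext_scale mult_single distrib_left scale_pm_mult_right
            case_prod_unfold)
  qed (simp_all add: lin_ext_add lin_ext_scale distrib_right scale_pm_mult_left)
  then have r: "?r (x + y) = ?r x * ?r y" for x y
    by (simp add: case_prod_unfold sym_comult_monomial)
  show "lin_ext ?l (sym_comult_alg (p * q)) = lin_ext ?l (sym_comult_alg p) * lin_ext ?l (sym_comult_alg q)" for p q
    unfolding sym_comult_mult by (rule lin_ext_mult[OF l])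
  show "lin_ext ?r (sym_comult_alg (p * q)) = lin_ext ?r (sym_comult_alg p) * lin_ext ?r (sym_comult_alg q)" for p q
    unfolding sym_comult_mult by (rule lin_ext_mult[OF r])
  have one: "(1 :: ('n \<Rightarrow>\<^sub>0 nat) \<times> ('n \<Rightarrow>\<^sub>0 nat) \<Rightarrow>\<^sub>0 'k) = Poly_Mapping.single (0, 0) 1"
    by (simp flip: zero_prod_def)
  show "lin_ext ?l (sym_comult_alg 1) = lin_ext ?r (sym_comult_alg 1)"
    by (simp add: one)
  have g: "sym_comult_alg (Poly_Mapping.single (Poly_Mapping.single i 1) 1 :: ('n, 'k) sym)
     = Poly_Mapping.single (Poly_Mapping.single i 1, 0) 1 + Poly_Mapping.single (0, Poly_Mapping.single i 1) 1" for i
    using sym_comult_gen[of i] by (simp add: sym_gen_def flip: single_one del: single_one)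
  show "lin_ext ?l (sym_comult_alg (sym_gen i)) = lin_ext ?r (sym_comult_alg (sym_gen i))" for i
    by (simp add: sym_gen_def g one lin_ext_add add_ac)
qed (intro black_prod_lin_intros pm_linear_sym_comult)+

lemma monomial_add_eq_0_iff: "m + n = 0 \<longleftrightarrow> m = 0 \<and> n = (0 :: 'n::finite \<Rightarrow>\<^sub>0 nat)"
  by (metis add_eq_0_iff_both_eq_0 mdeg_add mdeg_eq_0_iff)

lemma monomial_gen_neq_0 [simp]: "Poly_Mapping.single (i::'n::finite) (1::nat) \<noteq> 0"
  by (metis mdeg_single mdeg_zero one_neq_zero)

lemma sym_comult_counit_left:
  fixes p :: "('n::finite, 'k::field) sym"
  shows "lin_ext (\<lambda>(m, n). scale_pm (Poly_Mapping.lookup (Poly_Mapping.single m 1) 0) (Poly_Mapping.single n 1)) (sym_comult_alg p) = p"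
    (is "lin_ext ?f _ = _")
proof (rule sym_alg_hom_eq[where p = p and g = "\<lambda>p. p"])
  \<comment> \<open>A product of monomials is 1 only if both factors are, since exponents are
    natural numbers.\<close>
  have "?f (x + y) = ?f x * ?f y" for x y
    by (auto simp: case_prod_unfold lookup_single when_def mult_single monomial_add_eq_0_iff)
  then show "lin_ext ?f (sym_comult_alg (p * q)) = lin_ext ?f (sym_comult_alg p) * lin_ext ?f (sym_comult_alg q)" for p q
    unfolding sym_comult_mult by (rule lin_ext_mult)
  show "lin_ext ?f (sym_comult_alg 1) = 1"
    by (simp add: case_prod_unfold)
  show "lin_ext ?f (sym_comult_alg (sym_gen i)) = sym_gen i" for i
    unfolding sym_comult_gen by (simp add: sym_gen_def lin_ext_add lookup_single monomial_gen_neq_0)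
qed (intro black_prod_lin_intros pm_linear_sym_comult refl)+

lemma sym_comult_counit_right:
  fixes p :: "('n::finite, 'k::field) sym"
  shows "lin_ext (\<lambda>(m, n). scale_pm (Poly_Mapping.lookup (Poly_Mapping.single n 1) 0) (Poly_Mapping.single m 1)) (sym_comult_alg p) = p"
    (is "lin_ext ?f _ = _")
proof (rule sym_alg_hom_eq[where p = p and g = "\<lambda>p. p"])
  have "?f (x + y) = ?f x * ?f y" for x y
    by (auto simp: case_prod_unfold lookup_single when_def mult_single monomial_add_eq_0_iff)
  then show "lin_ext ?f (sym_comult_alg (p * q)) = lin_ext ?f (sym_comult_alg p) * lin_ext ?f (sym_comult_alg q)" for p q
    unfolding sym_comult_mult by (rule lin_ext_mult)
  show "lin_ext ?f (sym_comult_alg 1) = 1"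
    by (simp add: case_prod_unfold)
  show "lin_ext ?f (sym_comult_alg (sym_gen i)) = sym_gen i" for i
    unfolding sym_comult_gen by (simp add: sym_gen_def lin_ext_add lookup_single monomial_gen_neq_0)
qed (intro black_prod_lin_intros pm_linear_sym_comult refl)+

section \<open>Linear maps out of the symmetric algebra\<close>

lemma black_prod_gen_gen: "black_prod a (sym_gen i) (sym_gen j) = sym_gen i * sym_gen j + scale_pm (a $ j) (sym_gen i)"
  using black_prod_monomial_gen[of a "Poly_Mapping.single i 1" j] by (simp add: sym_gen_def mult_single)

lemma lookup_sum_list_single:
  "Poly_Mapping.lookup (\<Sum>i\<leftarrow>is. Poly_Mapping.single i (1::nat)) j = count (mset is) j"
  by (induction "is") (simp_all add: lookup_add lookup_single)

lemma sum_list_single_eqD: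
  "(\<Sum>i\<leftarrow>is. Poly_Mapping.single i (1::nat)) = (\<Sum>i\<leftarrow>js. Poly_Mapping.single i 1) \<Longrightarrow> mset is = mset js"
  by (metis lookup_sum_list_single multiset_eqI)

text \<open>The operator \<open>B i\<close> stands for the wanted effect of appending
  \<open>\<epsilon>\<^sub>i\<close>. The head of the list acts last, after \<open>length is\<close>
  other letters, whence its shift.\<close>

fun shifted_word ::
  "('n \<Rightarrow> ('y \<Rightarrow>\<^sub>0 'k::field) \<Rightarrow> ('y \<Rightarrow>\<^sub>0 'k)) \<Rightarrow> 'k ^ 'n::finite \<Rightarrow> ('y \<Rightarrow>\<^sub>0 'k) \<Rightarrow> 'n list \<Rightarrow> ('y \<Rightarrow>\<^sub>0 'k)"
where
  "shifted_word B a w [] = w"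
| "shifted_word B a w (i # is) = B i (shifted_word B a w is) - scale_pm (of_nat (length is) * a $ i) (shifted_word B a w is)"

text \<open>Multiplication by \<open>\<epsilon>\<^sub>i\<close> sends a monomial \<open>m\<close> of degree \<open>r\<close> to \<open>m \<triangleleft> \<epsilon>\<^sub>i - r a\<^sub>i m\<close>, so the image of a
  monomial is forced to be a \<open>shifted_word\<close>. The Lie relations make the operators
  \<open>B\<^sub>j - (r + 1) a\<^sub>j\<close> and \<open>B\<^sub>i - r a\<^sub>i\<close> exchange their indices, so the order of the letters is irrelevant.\<close>

lemma sym_lift:
  fixes a :: "'k::field ^ 'n::finite" and B :: "'n \<Rightarrow> ('y \<Rightarrow>\<^sub>0 'k) \<Rightarrow> ('y \<Rightarrow>\<^sub>0 'k)"
  assumes lin: "\<And>i. pm_linear (B i)"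
    and N: "pm.subspace N" and stable: "\<And>i x. x \<in> N \<Longrightarrow> B i x \<in> N"
    and rel: "\<And>i j x. B j (B i x) - B i (B j x) - (scale_pm (a $ j) (B i x) - scale_pm (a $ i) (B j x)) \<in> N"
  obtains \<Phi> where "pm_linear \<Phi>" "\<Phi> 1 = w" "\<And>p i. \<Phi> (black_prod a p (sym_gen i)) - B i (\<Phi> p) \<in> N"
proof -
  let ?f = "shifted_word B a w"
  have N0: "0 \<in> N" by (rule pm.subspace_0[OF N])
  note Nadd = pm.subspace_add[OF N] and Nscale = pm.subspace_scale[OF N] and Ndiff = pm.subspace_diff[OF N]
  note Bs = pm_linear_add[OF lin] pm_linear_diff[OF lin] pm_linear_scale[OF lin]
  have Ntrans: "x - z \<in> N" if "x - y \<in> N" "y - z \<in> N" for x y z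
    using Nadd[OF that] by simp
  \<comment> \<open>The operators descend to the quotient by \<open>N\<close>; equal lengths ensure
    that both words receive the same shift.\<close>
  have cong: "?f (i # xs) - ?f (i # ys) \<in> N" if "?f xs - ?f ys \<in> N" "length xs = length ys" for i xs ys
  proof -
    have "?f (i # xs) - ?f (i # ys) = B i (?f xs - ?f ys) - scale_pm (of_nat (length ys) * a $ i) (?f xs - ?f ys)"
      using that by (simp add: Bs pm.scale_right_diff_distrib)
    then show ?thesis using that stable Nscale Ndiff by metis
  qed
  \<comment> \<open>The products of two shifts are symmetric in \<open>i\<close> and
    \<open>j\<close> and cancel. The two shifts differ by exactly 1, so of the mixed terms a single
    copy remains, and it is the bracket in \<open>rel\<close>.\<close>
  have swap: "?f (i # j # xs) - ?f (j # i # xs) \<in> N" for i j xs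
  proof -
    let ?x = "?f xs"
    have "?f (i # j # xs) - ?f (j # i # xs)
      = B i (B j ?x) - B j (B i ?x) - (scale_pm (a $ i) (B j ?x) - scale_pm (a $ j) (B i ?x))"
      by (simp add: Bs pm.scale_right_diff_distrib algebra_simps pm.scale_left_distrib)
    then show ?thesis using rel[of i j ?x] by simp
  qed
  have front: "?f (us @ i # vs) - ?f (i # us @ vs) \<in> N" for us i vs
  proof (induction us)
    case (Cons u us)
    show ?case
      using Ntrans[OF cong[OF Cons, of u] swap[of u i "us @ vs"]] by simp
  qed (simp add: N0)
  have perm: "?f xs - ?f ys \<in> N" if "mset xs = mset ys" for xs ys
    using that
  proof (induction xs arbitrary: ys)
    case (Cons x xs)
    then obtain us vs where ys: "ys = us @ x # vs"
      by (metis list.set_intros(1) mset_eq_setD split_list)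
    with Cons.prems have m: "mset xs = mset (us @ vs)" by simp
    have "?f (x # xs) - ?f (x # us @ vs) \<in> N"
      by (rule cong[OF Cons.IH[OF m] mset_eq_length[OF m]])
    moreover have "?f (x # us @ vs) - ?f ys \<in> N"
      using pm.subspace_neg[OF N front[of us x vs]] by (simp add: ys)
    ultimately show ?case by (rule Ntrans)
  qed (simp add: N0)
  \<comment> \<open>A monomial has no preferred word. One is chosen for each, so that
    \<open>\<Phi>\<close> is linear exactly; that the choices are compatible is needed only modulo
    \<open>N\<close>, where \<open>perm\<close> applies.\<close>
  define L where "L m = (SOME is. m = (\<Sum>i\<leftarrow>is. Poly_Mapping.single (i::'n) (1::nat)))" for m
  have L: "m = (\<Sum>i\<leftarrow>L m. Poly_Mapping.single i 1)" for m
    unfolding L_def using ex_monomial_list[of m] by (rule someI_ex)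
  have len: "length (L m) = mdeg m" for m
    by (metis L mdeg_sum_list)
  define \<Phi> where "\<Phi> = lin_ext (\<lambda>m. ?f (L m))"
  have \<Phi>lin: "pm_linear \<Phi>" by (simp add: \<Phi>_def)
  have "\<Phi> (black_prod a p (sym_gen i)) - B i (\<Phi> p) \<in> N" for p i
  proof (induction p rule: pm_induct)
    case (basis m)
    \<comment> \<open>The summand deg m times \<open>a\<^sub>i\<close> m of m \<triangleleft>
      \<open>\<epsilon>\<^sub>i\<close> will cancel the shift in the word \<open>i # L m\<close>,
      because \<open>L m\<close> has length \<open>mdeg m\<close>.\<close>
    have "(\<Sum>k\<leftarrow>L (m + Poly_Mapping.single i 1). Poly_Mapping.single k (1::nat)) = (\<Sum>k\<leftarrow>i # L m. Poly_Mapping.single k 1)"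
      unfolding L[symmetric] by (simp add: L[of m, symmetric] add.commute)
    then have "?f (L (m + Poly_Mapping.single i 1)) - ?f (i # L m) \<in> N"
      by (intro perm sum_list_single_eqD)
    then show ?case
      by (simp add: \<Phi>_def black_prod_monomial_gen lin_ext_add len algebra_simps)
  next
    case (add p q)
    have "\<Phi> (black_prod a (p + q) (sym_gen i)) - B i (\<Phi> (p + q))
      = (\<Phi> (black_prod a p (sym_gen i)) - B i (\<Phi> p)) + (\<Phi> (black_prod a q (sym_gen i)) - B i (\<Phi> q))"
      by (simp add: black_prod_add_left pm_linear_add[OF \<Phi>lin] Bs)
    then show ?case using Nadd[OF add] by simp
  next
    case (scale c p)
    have "\<Phi> (black_prod a (scale_pm c p) (sym_gen i)) - B i (\<Phi> (scale_pm c p))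
      = scale_pm c (\<Phi> (black_prod a p (sym_gen i)) - B i (\<Phi> p))"
      by (simp add: black_prod_scale_left pm_linear_scale[OF \<Phi>lin] Bs pm.scale_right_diff_distrib)
    then show ?case using Nscale[OF scale] by simp
  qed (simp_all add: \<Phi>_def N0 pm_linear_0[OF lin])
  moreover have "\<Phi> 1 = w"
    using len[of 0] by (simp add: \<Phi>_def)
  ultimately show thesis using that \<Phi>lin by blast
qed

text \<open>The composite of A \<otimes> A' with the multiplication \<triangleleft>; precomposed
  with the coproduct it is the convolution of A and A'.\<close>

definition mult_tens where
  "mult_tens a A A' = lin_ext (\<lambda>(m, n). black_prod a (A (Poly_Mapping.single m 1)) (A' (Poly_Mapping.single n 1)))"

lemma mult_tens_tens:
  assumes "pm_linear A" "pm_linear A'"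
  shows "mult_tens a A A' (tens p q) = black_prod a (A p) (A' q)"
  unfolding mult_tens_def
  by (rule lin_ext_bilinear[of "\<lambda>p q. black_prod a (A p) (A' q)"]) (intro black_prod_lin_intros assms)+

lemma lookup_gen_zero [simp]: "Poly_Mapping.lookup (sym_gen (i::'n::finite)) 0 = (0 :: 'k::field)"
  by (auto simp: sym_gen_def lookup_single when_def)

text \<open>An antipode reverses products and negates primitive elements, so it must send p
  \<triangleleft> \<open>\<epsilon>\<^sub>i\<close> to - \<open>\<epsilon>\<^sub>i\<close>
  \<triangleleft> A p. Such a map is obtained from \<open>sym_lift\<close> with left multiplications
  and the zero subspace.\<close>

lemma sym_antipode:
  fixes a :: "'k::field ^ 'n::finite"
  obtains A where "pm_linear A"
    "\<And>p. mult_tens a A (\<lambda>q. q) (sym_comult_alg p) = scale_pm (Poly_Mapping.lookup p 0) 1"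
    "\<And>p. mult_tens a (\<lambda>q. q) A (sym_comult_alg p) = scale_pm (Poly_Mapping.lookup p 0) 1"
proof -
  let ?B = "\<lambda>i x. - black_prod a (sym_gen i) x"
  have comm: "black_prod a (sym_gen j) (sym_gen i) = black_prod a (sym_gen i) (sym_gen j)
      + (scale_pm (a $ i) (sym_gen j) - scale_pm (a $ j) (sym_gen i))" for i j
    by (simp add: black_prod_gen_gen mult.commute)
  obtain A where A: "pm_linear A" "A 1 = 1" "\<And>p i. A (black_prod a p (sym_gen i)) - ?B i (A p) \<in> {0}"
  proof (rule sym_lift[of ?B "{0}" a 1])
    show "pm_linear (?B i)" for i
      by (rule pm_linearI) (simp_all add: black_prod_add_right black_prod_scale_right)
    \<comment> \<open>Left multiplications compose in the opposite order; the sign in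
      \<open>?B\<close> compensates for this.\<close>
    show "?B j (?B i x) - ?B i (?B j x) - (scale_pm (a $ j) (?B i x) - scale_pm (a $ i) (?B j x)) \<in> {0}" for i j x
    proof -
      have "?B j (?B i x) - ?B i (?B j x) = black_prod a (black_prod a (sym_gen j) (sym_gen i)) x - black_prod a (black_prod a (sym_gen i) (sym_gen j)) x"
        by (simp add: black_prod_assoc pm_linear_neg[OF pm_linear_black_prod_right[OF pm_linear_id]])
      also have "\<dots> = scale_pm (a $ i) (black_prod a (sym_gen j) x) - scale_pm (a $ j) (black_prod a (sym_gen i) x)"
        by (simp add: comm[of i j] black_prod_add_left black_prod_diff_left black_prod_scale_left)
      finally show ?thesis by simp
    qed
  qed (simp_all add: pm.subspace_0)
  have Agen: "A (black_prod a p (sym_gen i)) = - black_prod a (sym_gen i) (A p)" for p i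
    using A(3)[of p i] by (simp add: eq_neg_iff_add_eq_0)
  have Agen1: "A (sym_gen i) = - sym_gen i" for i
    using Agen[of 1 i] by (simp add: A(2))
  have neg: "black_prod a (- p) q = - black_prod a p q" "black_prod a p (- q) = - black_prod a p q" for p q
    by (rule pm_linear_neg[OF pm_linear_black_prod_left[OF pm_linear_id]])
       (rule pm_linear_neg[OF pm_linear_black_prod_right[OF pm_linear_id]])
  note MT = mult_tens_tens[OF A(1) pm_linear_id] mult_tens_tens[OF pm_linear_id A(1)]
  have lin: "pm_linear (mult_tens a f g)" for f g
    by (simp add: mult_tens_def)
  \<comment> \<open>The outcome is a commutator with \<open>\<epsilon>\<^sub>i\<close>. It vanishes
    once the inner convolution is known to be a scalar, which the final induction supplies.\<close>
  have L: "mult_tens a A (\<lambda>q. q) (black_prod2 a Z (sym_comult_alg (sym_gen i)))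
     = black_prod a (mult_tens a A (\<lambda>q. q) Z) (sym_gen i) - black_prod a (sym_gen i) (mult_tens a A (\<lambda>q. q) Z)" for Z i
  proof (induction Z rule: tens_induct)
    case (add p q)
    then show ?case
      by (simp add: black_prod2_add_left black_prod_add_left black_prod_add_right pm_linear_add[OF lin])
  qed (simp_all add: sym_comult_gen pm_linear_0[OF lin] black_prod2_add_right
          pm_linear_add[OF lin] black_prod2_tens MT Agen neg black_prod_assoc)
  \<comment> \<open>On this side the two summands of the coproduct of
    \<open>\<epsilon>\<^sub>i\<close> meet in the middle of the product and cancel for every
    \<open>Z\<close>.\<close>
  have R: "mult_tens a (\<lambda>q. q) A (black_prod2 a Z (sym_comult_alg (sym_gen i))) = 0" for Z i
  proof (induction Z rule: tens_induct)
    case (add p q)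
    then show ?case by (simp add: black_prod2_add_left pm_linear_add[OF lin])
  qed (simp_all add: sym_comult_gen pm_linear_0[OF lin] black_prod2_add_right
          pm_linear_add[OF lin] black_prod2_tens MT Agen neg black_prod_assoc)
  have mult_one: "mult_tens a f g 1 = black_prod a (f 1) (g 1)" for f g
    by (simp add: mult_tens_def case_prod_unfold)
  show thesis
  proof
    show "mult_tens a A (\<lambda>q. q) (sym_comult_alg p) = scale_pm (Poly_Mapping.lookup p 0) 1" for p
      by (induction p rule: black_prod_induct[of _ a])
         (simp_all add: mult_one A(2) sym_comult_black_prod L lookup_black_prod_zero lookup_add
          pm_linear_0 pm_linear_0[OF lin] pm_linear_add pm_linear_add[OF lin]
          pm_linear_scale pm_linear_scale[OF lin] pm.scale_left_distrib black_prod_scale_left black_prod_scale_right)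
    show "mult_tens a (\<lambda>q. q) A (sym_comult_alg p) = scale_pm (Poly_Mapping.lookup p 0) 1" for p
      by (induction p rule: black_prod_induct[of _ a])
         (simp_all add: mult_one A(2) sym_comult_black_prod R lookup_black_prod_zero lookup_add
          pm_linear_0 pm_linear_0[OF lin] pm_linear_add pm_linear_add[OF lin]
          pm_linear_scale pm_linear_scale[OF lin] pm.scale_left_distrib)
  qed (rule A)
qed

section \<open>Hopf algebras modelled on the symmetric algebra\<close>

lemma lin_ext_cong:
  "p = q \<Longrightarrow> (\<And>x. x \<in> Poly_Mapping.keys q \<Longrightarrow> f x = f' x) \<Longrightarrow> lin_ext f p = lin_ext f' q"
  by (simp add: lin_ext_def)

lemma keys_scale_pm: "Poly_Mapping.keys (scale_pm c p) \<subseteq> Poly_Mapping.keys p"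
  by (auto simp: in_keys_iff)

lemma keys_lin_ext:
  assumes "\<And>x. x \<in> Poly_Mapping.keys p \<Longrightarrow> Poly_Mapping.keys (f x) \<subseteq> S"
  shows "Poly_Mapping.keys (lin_ext f p) \<subseteq> S"
proof
  fix y assume "y \<in> Poly_Mapping.keys (lin_ext f p)"
  then have "(\<Sum>x\<in>Poly_Mapping.keys p. Poly_Mapping.lookup p x * Poly_Mapping.lookup (f x) y) \<noteq> 0"
    by (simp add: lin_ext_def in_keys_iff lookup_sum)
  then obtain x where "x \<in> Poly_Mapping.keys p" "Poly_Mapping.lookup p x * Poly_Mapping.lookup (f x) y \<noteq> 0"
    using sum.not_neutral_contains_not_neutral by blast
  then show "y \<in> S" using assms[of x] by (auto simp: in_keys_iff)
qed

lemma lin_ext_diff_in_subspace: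
  assumes "pm.subspace N" "\<And>x. x \<in> Poly_Mapping.keys p \<Longrightarrow> f x - f' x \<in> N"
  shows "lin_ext f p - lin_ext f' p \<in> N"
proof -
  have "lin_ext f p - lin_ext f' p
      = (\<Sum>x\<in>Poly_Mapping.keys p. scale_pm (Poly_Mapping.lookup p x) (f x - f' x))"
    by (simp add: lin_ext_def pm.scale_right_diff_distrib sum_subtractf)
  then show ?thesis
    using assms by (auto intro!: pm.subspace_sum pm.subspace_scale)
qed

text \<open>Moves a bilinear expression in the two slots of a coproduct from the carrier of a Hopf
  structure to the tensor square of S.\<close>

lemma lin_ext_bilinear_push:
  assumes "\<And>q. pm_linear (\<lambda>p. B p q)" "\<And>p. pm_linear (\<lambda>q. B p q)"
  shows "lin_ext (\<lambda>(x, y). B (g x) (g' y)) p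
    = lin_ext (\<lambda>(m, n). B (Poly_Mapping.single m 1) (Poly_Mapping.single n 1))
        (lin_ext (\<lambda>(x, y). tens (g x) (g' y)) p)"
  by (simp add: lin_ext_lin_ext case_prod_unfold)
     (simp add: lin_ext_bilinear[OF assms, unfolded case_prod_unfold])

lemma cring_of_field: "cring (ring_of_type_algebra :: 'k::field ring)"
  by (rule cring_from_type_algebra)

text \<open>A Hopf structure is treated through a bijection \<open>g\<close> of its carrier with the symmetric algebra
  that intertwines all operations. Identities between tensors are checked after applying \<open>g\<close> to every
  tensor factor.\<close>

locale sym_model =
  fixes a :: "'k::field ^ 'n::finite" and H :: "('k, 'h, 'm) hopf_scheme" (structure)
    and g :: "'h \<Rightarrow> ('n, 'k) sym"
  assumes g_bij: "bij_betw g (carrier H) UNIV"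
    and mult_closed: "\<lbrakk>x \<in> carrier H; y \<in> carrier H\<rbrakk> \<Longrightarrow> x \<otimes> y \<in> carrier H"
    and add_closed: "\<lbrakk>x \<in> carrier H; y \<in> carrier H\<rbrakk> \<Longrightarrow> x \<oplus> y \<in> carrier H"
    and one_closed: "\<one> \<in> carrier H" and zero_closed: "\<zero> \<in> carrier H"
    and smult_closed: "x \<in> carrier H \<Longrightarrow> c \<odot> x \<in> carrier H"
    and g_mult: "\<lbrakk>x \<in> carrier H; y \<in> carrier H\<rbrakk> \<Longrightarrow> g (x \<otimes> y) = black_prod a (g x) (g y)"
    and g_add: "\<lbrakk>x \<in> carrier H; y \<in> carrier H\<rbrakk> \<Longrightarrow> g (x \<oplus> y) = g x + g y"
    and g_one: "g \<one> = 1" and g_zero: "g \<zero> = 0"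
    and g_smult: "x \<in> carrier H \<Longrightarrow> g (c \<odot> x) = scale_pm c (g x)"
    and comult_keys: "x \<in> carrier H \<Longrightarrow> Poly_Mapping.keys (comult H x) \<subseteq> carrier H \<times> carrier H"
    and g_comult: "x \<in> carrier H \<Longrightarrow>
      lin_ext (\<lambda>(y, z). tens (g y) (g z)) (comult H x) = sym_comult_alg (g x)"
    and g_counit: "x \<in> carrier H \<Longrightarrow> counit H x = Poly_Mapping.lookup (g x) 0"
begin

section \<open>Transport of structure along the bijection\<close>

definition from_sym where "from_sym = inv_into (carrier H) g"

lemma from_sym_closed: "from_sym p \<in> carrier H"
  using g_bij unfolding from_sym_def bij_betw_def by (metis UNIV_I inv_into_into)

lemma g_from_sym: "g (from_sym p) = p"
  using g_bij unfolding from_sym_def bij_betw_def by (metis UNIV_I f_inv_into_f)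

lemma g_inj: "\<lbrakk>x \<in> carrier H; y \<in> carrier H; g x = g y\<rbrakk> \<Longrightarrow> x = y"
  using g_bij unfolding bij_betw_def inj_on_def by blast

lemma from_sym_g: "x \<in> carrier H \<Longrightarrow> from_sym (g x) = x"
  by (rule g_inj) (simp_all add: from_sym_closed g_from_sym)

lemmas model_closed = mult_closed add_closed one_closed zero_closed smult_closed from_sym_closed
lemmas model_simps = g_mult g_add g_one g_zero g_smult g_from_sym model_closed

lemma abelian_group: "abelian_group H"
proof (rule abelian_groupI)
  show "\<exists>y\<in>carrier H. y \<oplus> x = \<zero>" if "x \<in> carrier H" for x
    using that by (intro bexI[of _ "from_sym (- g x)"]) (auto intro: g_inj simp: model_simps)
qed (auto intro: g_inj simp: model_simps algebra_simps)

lemma ring: "ring H"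
proof (rule ringI[OF abelian_group])
  show "Group.monoid H"
    by (rule monoidI) (auto intro: g_inj simp: model_simps black_prod_assoc)
qed (auto intro: g_inj simp: model_simps black_prod_add_left black_prod_add_right)

lemma module: "Module.module ring_of_type_algebra H"
  by (rule moduleI[OF cring_of_field abelian_group])
     (auto intro: g_inj simp: model_simps ring_of_type_algebra_def pm.scale_left_distrib pm.scale_right_distrib)

lemma g_finsum:
  assumes "finite K" "\<And>k. k \<in> K \<Longrightarrow> F k \<in> carrier H"
  shows "finsum H F K \<in> carrier H \<and> g (finsum H F K) = (\<Sum>k\<in>K. g (F k))"
proof -
  interpret abelian_group H by (rule abelian_group)
  show ?thesis using assms
    by (induction K) (auto simp: finsum_insert Pi_def g_zero g_add)
qed

lemma tensor2_eval_closed: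
  assumes "Poly_Mapping.keys p \<subseteq> carrier H \<times> carrier H"
    "\<And>x y. \<lbrakk>x \<in> carrier H; y \<in> carrier H\<rbrakk> \<Longrightarrow> f x y \<in> carrier H"
  shows "tensor2_eval H f p \<in> carrier H"
  unfolding tensor2_eval_def using assms
  by (intro conjunct1[OF g_finsum]) (auto intro!: smult_closed)

lemma g_tensor2_eval:
  assumes "Poly_Mapping.keys p \<subseteq> carrier H \<times> carrier H"
    "\<And>x y. \<lbrakk>x \<in> carrier H; y \<in> carrier H\<rbrakk> \<Longrightarrow> f x y \<in> carrier H"
    "\<And>x y. \<lbrakk>x \<in> carrier H; y \<in> carrier H\<rbrakk> \<Longrightarrow> g (f x y) = B (g x) (g y)"
  shows "g (tensor2_eval H f p) = lin_ext (\<lambda>(x, y). B (g x) (g y)) p"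
  unfolding tensor2_eval_def lin_ext_def using assms
  by (subst conjunct2[OF g_finsum]) (auto intro!: sum.cong smult_closed simp: g_smult)

text \<open>By injectivity of \<open>g\<close>, its inverse is linear. Hence the relators of one
  slot allow the entry there to be replaced by its expansion in the basis carried over from the
  monomials.\<close>

lemma single_slot_equiv:
  assumes "slot_relators H f \<subseteq> S" "x \<in> carrier H"
  shows "Poly_Mapping.single (f x) 1 - lin_ext (\<lambda>m. Poly_Mapping.single (f (from_sym (Poly_Mapping.single m 1))) 1) (g x)
    \<in> pm.span S"
proof -
  have plus: "Poly_Mapping.single (f (x \<oplus> y)) 1 - Poly_Mapping.single (f x) 1 - Poly_Mapping.single (f y) 1 \<in> pm.span S"
    if "x \<in> carrier H" "y \<in> carrier H" for x y
    using that by (intro pm.span_base subsetD[OF assms(1)]) (auto simp: slot_relators_def)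
  have smult: "Poly_Mapping.single (f (c \<odot> x)) 1 - Poly_Mapping.single (f x) c \<in> pm.span S"
    if "x \<in> carrier H" for c x
    using that by (intro pm.span_base subsetD[OF assms(1)]) (auto simp: slot_relators_def)
  let ?F = "lin_ext (\<lambda>m. Poly_Mapping.single (f (from_sym (Poly_Mapping.single m 1))) 1)"
  have "Poly_Mapping.single (f (from_sym p)) 1 - ?F p \<in> pm.span S" for p
  proof (induction p rule: pm_induct)
    case zero
    \<comment> \<open>The homogeneity relator for the scalar 0 puts the symbol of the zero vector
      into the span.\<close>
    have "from_sym 0 = 0 \<odot> from_sym 0" by (rule g_inj) (simp_all add: model_simps)
    then show ?case using smult[OF from_sym_closed, of 0 0] by simp
  next
    case (basis m)
    then show ?case by (simp add: pm.span_zero)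
  next
    case (add p q)
    have "from_sym (p + q) = from_sym p \<oplus> from_sym q" by (rule g_inj) (simp_all add: model_simps)
    then show ?case
      using pm.span_add[OF pm.span_add[OF add] plus[OF from_sym_closed from_sym_closed, of p q]]
      by (simp add: lin_ext_add algebra_simps)
  next
    case (scale c p)
    have "from_sym (scale_pm c p) = c \<odot> from_sym p" by (rule g_inj) (simp_all add: model_simps)
    then show ?case
      using pm.span_add[OF pm.span_scale[OF scale, of c] smult[OF from_sym_closed, of c p]]
      by (simp add: lin_ext_scale pm.scale_right_diff_distrib)
  qed
  from this[of "g x"] show ?thesis by (simp add: from_sym_g assms(2))
qed

text \<open>The maps g \<otimes> g and g \<otimes> g \<otimes> g on representing combinations, with
  values in spaces that have tuples of monomials as a basis.\<close>

abbreviation "ev2 \<equiv> lin_ext (\<lambda>(x, y). tens (g x) (g y))"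
abbreviation "ev3 \<equiv> lin_ext (\<lambda>(x, y, z). tens (g x) (tens (g y) (g z)))"

text \<open>Expanding one slot after the other brings \<open>p\<close>, modulo multilinearity, to a
  normal form \<open>?nf\<close> that depends only on \<open>ev2 p\<close>.\<close>

lemma tensor2_eqI:
  assumes "Poly_Mapping.keys p \<subseteq> carrier H \<times> carrier H" "Poly_Mapping.keys q \<subseteq> carrier H \<times> carrier H"
    "ev2 p = ev2 q"
  shows "tensor2_eq H p q"
proof -
  let ?S = "\<Union>u\<in>carrier H. slot_relators H (\<lambda>x. (x, u)) \<union> slot_relators H (\<lambda>x. (u, x))"
  let ?e = "\<lambda>m. from_sym (Poly_Mapping.single m 1)"
  let ?nf = "lin_ext (\<lambda>(m, n). Poly_Mapping.single (?e m, ?e n) 1)"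
  have single: "Poly_Mapping.single (x, y) 1 - ?nf (tens (g x) (g y)) \<in> pm.span ?S"
    if "x \<in> carrier H" "y \<in> carrier H" for x y
  proof -
    have "Poly_Mapping.single (x, y) 1 - lin_ext (\<lambda>m. Poly_Mapping.single (?e m, y) 1) (g x) \<in> pm.span ?S"
      using that by (intro single_slot_equiv[where f = "\<lambda>x. (x, y)"]) auto
    moreover have "lin_ext (\<lambda>m. Poly_Mapping.single (?e m, y) 1) (g x)
        - lin_ext (\<lambda>m. lin_ext (\<lambda>n. Poly_Mapping.single (?e m, ?e n) 1) (g y)) (g x) \<in> pm.span ?S"
      using that from_sym_closed
      by (intro lin_ext_diff_in_subspace pm.subspace_span single_slot_equiv) auto
    ultimately show ?thesis
      using pm.span_add by (fastforce simp: lin_ext_tens)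
  qed
  have nf: "p - ?nf (ev2 p) \<in> pm.span ?S" if "Poly_Mapping.keys p \<subseteq> carrier H \<times> carrier H" for p
  proof -
    have "lin_ext (\<lambda>z. Poly_Mapping.single z 1) p - lin_ext (\<lambda>z. ?nf (case z of (x, y) \<Rightarrow> tens (g x) (g y))) p \<in> pm.span ?S"
      using that single by (intro lin_ext_diff_in_subspace pm.subspace_span) auto
    then show ?thesis by (simp add: lin_ext_lin_ext)
  qed
  have "(p - ?nf (ev2 p)) - (q - ?nf (ev2 q)) \<in> pm.span ?S"
    by (intro pm.span_diff nf assms)
  then show ?thesis by (simp add: tensor2_eq_def assms(3))
qed

lemma tensor3_eqI:
  assumes "Poly_Mapping.keys p \<subseteq> carrier H \<times> carrier H \<times> carrier H"
    "Poly_Mapping.keys q \<subseteq> carrier H \<times> carrier H \<times> carrier H" "ev3 p = ev3 q"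
  shows "tensor3_eq H p q"
proof -
  let ?S = "\<Union>u\<in>carrier H. \<Union>v\<in>carrier H. slot_relators H (\<lambda>x. (x, u, v)) \<union>
      slot_relators H (\<lambda>x. (u, x, v)) \<union> slot_relators H (\<lambda>x. (u, v, x))"
  let ?e = "\<lambda>m. from_sym (Poly_Mapping.single m 1)"
  let ?nf = "lin_ext (\<lambda>(m, n, k). Poly_Mapping.single (?e m, ?e n, ?e k) 1)"
  have single: "Poly_Mapping.single (x, y, z) 1 - ?nf (tens (g x) (tens (g y) (g z))) \<in> pm.span ?S"
    if "x \<in> carrier H" "y \<in> carrier H" "z \<in> carrier H" for x y z
  proof -
    have 1: "Poly_Mapping.single (x, y, z) 1 - lin_ext (\<lambda>m. Poly_Mapping.single (?e m, y, z) 1) (g x) \<in> pm.span ?S"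
      using that by (intro single_slot_equiv[where f = "\<lambda>x. (x, y, z)"]) auto
    have 2: "lin_ext (\<lambda>m. Poly_Mapping.single (?e m, y, z) 1) (g x)
        - lin_ext (\<lambda>m. lin_ext (\<lambda>n. Poly_Mapping.single (?e m, ?e n, z) 1) (g y)) (g x) \<in> pm.span ?S"
      using that from_sym_closed
      by (intro lin_ext_diff_in_subspace pm.subspace_span single_slot_equiv[where f = "\<lambda>y. (_, y, z)"]) auto
    have 3: "lin_ext (\<lambda>m. lin_ext (\<lambda>n. Poly_Mapping.single (?e m, ?e n, z) 1) (g y)) (g x)
        - lin_ext (\<lambda>m. lin_ext (\<lambda>n. lin_ext (\<lambda>k. Poly_Mapping.single (?e m, ?e n, ?e k) 1) (g z)) (g y)) (g x) \<in> pm.span ?S"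
      using that from_sym_closed
      by (intro lin_ext_diff_in_subspace pm.subspace_span single_slot_equiv[where f = "\<lambda>z. (_, _, z)"]) auto
    show ?thesis
      using pm.span_add[OF pm.span_add[OF 1 2] 3] by (simp add: lin_ext_tens)
  qed
  have nf: "p - ?nf (ev3 p) \<in> pm.span ?S" if "Poly_Mapping.keys p \<subseteq> carrier H \<times> carrier H \<times> carrier H" for p
  proof -
    have "lin_ext (\<lambda>z. Poly_Mapping.single z 1) p
        - lin_ext (\<lambda>z. ?nf (case z of (x, y, z) \<Rightarrow> tens (g x) (tens (g y) (g z)))) p \<in> pm.span ?S"
      using that single by (intro lin_ext_diff_in_subspace pm.subspace_span) auto
    then show ?thesis by (simp add: lin_ext_lin_ext)
  qed
  have "(p - ?nf (ev3 p)) - (q - ?nf (ev3 q)) \<in> pm.span ?S"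
    by (intro pm.span_diff nf assms)
  then show ?thesis by (simp add: tensor3_eq_def assms(3))
qed

lemma keys_tensor2_mult:
  assumes "Poly_Mapping.keys p \<subseteq> carrier H \<times> carrier H" "Poly_Mapping.keys q \<subseteq> carrier H \<times> carrier H"
  shows "Poly_Mapping.keys (tensor2_mult H p q) \<subseteq> carrier H \<times> carrier H"
  unfolding tensor2_mult_def using assms
  by (auto intro!: keys_lin_ext mult_closed simp del: mem_Sigma_iff simp: case_prod_unfold)

lemma ev2_tensor2_mult:
  assumes "Poly_Mapping.keys p \<subseteq> carrier H \<times> carrier H" "Poly_Mapping.keys q \<subseteq> carrier H \<times> carrier H"
  shows "ev2 (tensor2_mult H p q) = black_prod2 a (ev2 p) (ev2 q)"
proof -
  have "ev2 (tensor2_mult H p q) = lin_ext (\<lambda>(x, y). lin_ext (\<lambda>(x', y'). tens (g (x \<otimes> x')) (g (y \<otimes> y'))) q) p"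
    by (simp add: tensor2_mult_def lin_ext_lin_ext case_prod_unfold)
  also have "\<dots> = lin_ext (\<lambda>z. lin_ext (\<lambda>z'. black_prod2 a (tens (g (fst z)) (g (snd z))) (tens (g (fst z')) (g (snd z')))) q) p"
    using assms by (intro lin_ext_cong refl) (auto intro!: lin_ext_cong dest!: subsetD[OF assms(1)] subsetD[OF assms(2)] simp: black_prod2_tens g_mult)
  also have "\<dots> = lin_ext (\<lambda>z. black_prod2 a (tens (g (fst z)) (g (snd z))) (ev2 q)) p"
    by (simp add: linear_lin_ext[OF pm_linear_black_prod2_right[OF pm_linear_id]] case_prod_unfold)
  also have "\<dots> = black_prod2 a (ev2 p) (ev2 q)"
    by (subst linear_lin_ext[OF pm_linear_black_prod2_left[OF pm_linear_id]]) (simp add: case_prod_unfold)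
  finally show ?thesis .
qed

lemma tensor3_coassoc:
  assumes x: "x \<in> carrier H"
  shows "tensor3_eq H
      (lin_ext (\<lambda>(y, z). lin_ext (\<lambda>(u, v). Poly_Mapping.single (u, v, z) 1) (comult H y)) (comult H x))
      (lin_ext (\<lambda>(y, z). lin_ext (\<lambda>(u, v). Poly_Mapping.single (y, u, v) 1) (comult H z)) (comult H x))"
    (is "tensor3_eq H ?l ?r")
proof (rule tensor3_eqI)
  note keys = comult_keys[OF x]
  show "Poly_Mapping.keys ?l \<subseteq> carrier H \<times> carrier H \<times> carrier H"
    "Poly_Mapping.keys ?r \<subseteq> carrier H \<times> carrier H \<times> carrier H"
    using keys comult_keys by (fastforce intro!: keys_lin_ext split: if_splits)+
  \<comment> \<open>The associator from (S \<otimes> S) \<otimes> S to S \<otimes> (S \<otimes> S):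
    triples are nested to the right, whereas \<Delta> \<otimes> id puts a pair into the first
    slot.\<close>
  define al where "al = (\<lambda>(q :: ('n \<Rightarrow>\<^sub>0 nat) \<times> ('n \<Rightarrow>\<^sub>0 nat) \<Rightarrow>\<^sub>0 'k) (w :: ('n, 'k) sym).
    lin_ext (\<lambda>(u, v). lin_ext (\<lambda>n. Poly_Mapping.single (u, v, n) (1::'k)) w) q)"
  have al_lin: "pm_linear (\<lambda>q. al q w)" "pm_linear (al q)" for q w
    by (simp_all add: al_def case_prod_unfold pm_linear_lin_ext_fun)
  have al_tens: "al (tens p q) w = tens p (tens q w)" for p q w
    by (simp add: al_def tens_def lin_ext_lin_ext)
  have "ev3 ?l = lin_ext (\<lambda>(y, z). lin_ext (\<lambda>(u, v). al (tens (g u) (g v)) (g z)) (comult H y)) (comult H x)"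
    by (simp add: lin_ext_lin_ext case_prod_unfold al_tens)
  also have "\<dots> = lin_ext (\<lambda>(y, z). al (sym_comult_alg (g y)) (g z)) (comult H x)"
    using keys by (intro lin_ext_cong refl)
      (auto simp: g_comult[symmetric] linear_lin_ext[OF al_lin(1)] case_prod_unfold)
  also have "\<dots> = lin_ext (\<lambda>(m, n). al (sym_comult_alg (Poly_Mapping.single m 1)) (Poly_Mapping.single n 1))
      (sym_comult_alg (g x))"
    unfolding g_comult[OF x, symmetric]
    by (rule lin_ext_bilinear_push[of "\<lambda>p q. al (sym_comult_alg p) q"])
       (intro al_lin pm_linear_comp[OF al_lin(1)] pm_linear_sym_comult)+
  also have "\<dots> = lin_ext (\<lambda>(m, n). lin_ext (\<lambda>(u, v). Poly_Mapping.single (m, u, v) 1)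
      (sym_comult_alg (Poly_Mapping.single n 1))) (sym_comult_alg (g x))"
    using sym_comult_coassoc[of "g x"] by (simp add: al_def)
  also have "\<dots> = lin_ext (\<lambda>(m, n). tens (Poly_Mapping.single m 1) (sym_comult_alg (Poly_Mapping.single n 1)))
      (sym_comult_alg (g x))"
    by (simp add: tens_def case_prod_unfold)
  also have "\<dots> = lin_ext (\<lambda>(y, z). tens (g y) (sym_comult_alg (g z))) (comult H x)"
    unfolding g_comult[OF x, symmetric]
    by (rule lin_ext_bilinear_push[of "\<lambda>p q. tens p (sym_comult_alg q)", symmetric])
       (intro black_prod_lin_intros pm_linear_sym_comult)+
  also have "\<dots> = lin_ext (\<lambda>(y, z). lin_ext (\<lambda>(u, v). tens (g y) (tens (g u) (g v))) (comult H z)) (comult H x)"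
    using keys by (intro lin_ext_cong refl)
      (auto simp: g_comult[symmetric] linear_lin_ext[OF pm_linear_tens_right[OF pm_linear_id]] case_prod_unfold)
  also have "\<dots> = ev3 ?r"
    by (simp add: lin_ext_lin_ext case_prod_unfold)
  finally show "ev3 ?l = ev3 ?r" .
qed

lemma antipode: "\<exists>s. is_antipode H s"
proof -
  obtain A where A: "pm_linear A"
    "\<And>p. mult_tens a A (\<lambda>q. q) (sym_comult_alg p) = scale_pm (Poly_Mapping.lookup p 0) 1"
    "\<And>p. mult_tens a (\<lambda>q. q) A (sym_comult_alg p) = scale_pm (Poly_Mapping.lookup p 0) 1"
    by (rule sym_antipode[of a]) blast
  let ?s = "\<lambda>x. from_sym (A (g x))"
  have "g (tensor2_eval H (\<lambda>y z. ?s y \<otimes> z) (comult H x)) = scale_pm (Poly_Mapping.lookup (g x) 0) 1"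
    "g (tensor2_eval H (\<lambda>y z. y \<otimes> ?s z) (comult H x)) = scale_pm (Poly_Mapping.lookup (g x) 0) 1"
    if x: "x \<in> carrier H" for x
  proof -
    have "g (tensor2_eval H (\<lambda>y z. ?s y \<otimes> z) (comult H x)) = lin_ext (\<lambda>(y, z). black_prod a (A (g y)) (g z)) (comult H x)"
      by (rule g_tensor2_eval[OF comult_keys[OF x], where B = "\<lambda>p q. black_prod a (A p) q"]) (simp_all add: model_simps)
    also have "\<dots> = mult_tens a A (\<lambda>q. q) (sym_comult_alg (g x))"
      unfolding g_comult[OF x, symmetric] mult_tens_def
      by (rule lin_ext_bilinear_push) (intro black_prod_lin_intros A(1))+
    finally show "g (tensor2_eval H (\<lambda>y z. ?s y \<otimes> z) (comult H x)) = scale_pm (Poly_Mapping.lookup (g x) 0) 1"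
      by (simp only: A(2))
    have "g (tensor2_eval H (\<lambda>y z. y \<otimes> ?s z) (comult H x)) = lin_ext (\<lambda>(y, z). black_prod a (g y) (A (g z))) (comult H x)"
      by (rule g_tensor2_eval[OF comult_keys[OF x], where B = "\<lambda>p q. black_prod a p (A q)"]) (simp_all add: model_simps)
    also have "\<dots> = mult_tens a (\<lambda>q. q) A (sym_comult_alg (g x))"
      unfolding g_comult[OF x, symmetric] mult_tens_def
      by (rule lin_ext_bilinear_push) (intro black_prod_lin_intros A(1))+
    finally show "g (tensor2_eval H (\<lambda>y z. y \<otimes> ?s z) (comult H x)) = scale_pm (Poly_Mapping.lookup (g x) 0) 1"
      by (simp only: A(3))
  qed
  then have "is_antipode H ?s"
    unfolding is_antipode_def
    by (auto intro!: g_inj tensor2_eval_closed comult_keys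
        simp: model_simps pm_linear_add[OF A(1)] pm_linear_scale[OF A(1)] g_counit)
  then show ?thesis by blast
qed

lemma tensor2_counit_left:
  assumes x: "x \<in> carrier H"
  shows "tensor2_eval H (\<lambda>y z. counit H y \<odot> z) (comult H x) = x"
proof (rule g_inj[OF _ x])
  have lin: "pm_linear (\<lambda>p. scale_pm (Poly_Mapping.lookup p 0) q)" for q :: "('n, 'k) sym"
    by (rule pm_linearI) (simp_all add: lookup_add pm.scale_left_distrib)
  have "g (tensor2_eval H (\<lambda>y z. counit H y \<odot> z) (comult H x))
      = lin_ext (\<lambda>(y, z). scale_pm (Poly_Mapping.lookup (g y) 0) (g z)) (comult H x)"
    by (rule g_tensor2_eval[OF comult_keys[OF x], where B = "\<lambda>p q. scale_pm (Poly_Mapping.lookup p 0) q"])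
       (simp_all add: model_simps g_counit)
  also have "\<dots> = g x"
    by (subst lin_ext_bilinear_push[of "\<lambda>p q. scale_pm (Poly_Mapping.lookup p 0) q", OF lin pm_linear_scale_fun[OF pm_linear_id]])
       (simp only: g_comult[OF x] sym_comult_counit_left)
  finally show "g (tensor2_eval H (\<lambda>y z. counit H y \<odot> z) (comult H x)) = g x" .
qed (auto intro!: tensor2_eval_closed comult_keys x smult_closed)

lemma tensor2_counit_right:
  assumes x: "x \<in> carrier H"
  shows "tensor2_eval H (\<lambda>y z. counit H z \<odot> y) (comult H x) = x"
proof (rule g_inj[OF _ x])
  have lin: "pm_linear (\<lambda>p. scale_pm (Poly_Mapping.lookup p 0) q)" for q :: "('n, 'k) sym"
    by (rule pm_linearI) (simp_all add: lookup_add pm.scale_left_distrib)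
  have "g (tensor2_eval H (\<lambda>y z. counit H z \<odot> y) (comult H x))
      = lin_ext (\<lambda>(y, z). scale_pm (Poly_Mapping.lookup (g z) 0) (g y)) (comult H x)"
    by (rule g_tensor2_eval[OF comult_keys[OF x], where B = "\<lambda>p q. scale_pm (Poly_Mapping.lookup q 0) p"])
       (simp_all add: model_simps g_counit)
  also have "\<dots> = g x"
    by (subst lin_ext_bilinear_push[of "\<lambda>p q. scale_pm (Poly_Mapping.lookup q 0) p", OF pm_linear_scale_fun[OF pm_linear_id] lin])
       (simp only: g_comult[OF x] sym_comult_counit_right)
  finally show "g (tensor2_eval H (\<lambda>y z. counit H z \<odot> y) (comult H x)) = g x" .
qed (auto intro!: tensor2_eval_closed comult_keys x smult_closed)

lemma hopf_algebra: "hopf_algebra H"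
proof (intro hopf_algebra.intro hopf_algebra_axioms.intro ring module)
  fix x y c assume x: "x \<in> carrier H"
  show "tensor2_eq H (comult H (c \<odot> x)) (scale_pm c (comult H x))"
    using order_trans[OF keys_scale_pm comult_keys[OF x], of c] x
    by (intro tensor2_eqI comult_keys smult_closed)
       (simp_all add: g_comult model_simps lin_ext_scale pm_linear_scale[OF pm_linear_sym_comult])
  assume y: "y \<in> carrier H"
  show "tensor2_eq H (comult H (x \<oplus> y)) (comult H x + comult H y)"
    using order_trans[OF keys_add, of "comult H x" "comult H y" "carrier H \<times> carrier H"] comult_keys[OF x] comult_keys[OF y] x y
    by (intro tensor2_eqI comult_keys add_closed)
       (simp_all add: g_comult model_simps lin_ext_add pm_linear_add[OF pm_linear_sym_comult])
  show "tensor2_eq H (comult H (x \<otimes> y)) (tensor2_mult H (comult H x) (comult H y))"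
    using x y by (intro tensor2_eqI comult_keys keys_tensor2_mult mult_closed)
       (simp_all add: g_comult g_mult mult_closed ev2_tensor2_mult comult_keys sym_comult_black_prod)
next
  show "tensor2_eq H (comult H \<one>) (Poly_Mapping.single (\<one>, \<one>) 1)"
    by (intro tensor2_eqI comult_keys one_closed) (simp_all add: g_comult g_one one_closed)
qed (auto intro: g_inj tensor3_coassoc tensor2_counit_left tensor2_counit_right antipode dest: subsetD[OF comult_keys]
      simp: model_simps g_counit lookup_add lookup_black_prod_zero black_prod_scale_left black_prod_scale_right)

lemma from_sym_hopf_iso: "from_sym \<in> hopf_iso (sym_hopf (black_prod a)) H"
proof -
  have hom: "from_sym \<in> ring_hom (sym_hopf (black_prod a)) H"
    by (rule ring_hom_memI) (auto intro: g_inj simp: sym_hopf_def model_simps)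
  have bij: "bij_betw from_sym UNIV (carrier H)"
    unfolding from_sym_def by (rule bij_betw_inv_into[OF g_bij])
  have "tensor2_eq H (comult H (from_sym p)) (lin_ext (\<lambda>(y, z). Poly_Mapping.single (from_sym y, from_sym z) 1) (comult (sym_hopf (black_prod a)) p))" for p
  proof (rule tensor2_eqI)
    show "ev2 (comult H (from_sym p)) = ev2 (lin_ext (\<lambda>(y, z). Poly_Mapping.single (from_sym y, from_sym z) 1) (comult (sym_hopf (black_prod a)) p))"
      using g_comult[OF from_sym_closed, of p]
      by (simp add: g_from_sym sym_hopf_def lin_ext_lin_ext case_prod_unfold)
  qed (auto intro!: comult_keys from_sym_closed keys_lin_ext)
  then show ?thesis
    using hom bij unfolding hopf_iso_def ring_iso_def
    by (auto intro: g_inj simp: sym_hopf_def model_simps g_counit)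
qed

end

text \<open>With the identity as the bijection, the locale yields the Hopf axioms of S
  itself.\<close>

lemma sym_model_sym_hopf: "sym_model a (sym_hopf (black_prod a)) (\<lambda>p. p)"
  by unfold_locales (simp_all add: sym_hopf_def bij_betw_def lin_ext_lin_ext case_prod_unfold)

section \<open>The enveloping algebra\<close>

definition vec_sym :: "'k::field ^ 'n::finite \<Rightarrow> ('n, 'k) sym" where
  "vec_sym v = (\<Sum>i\<in>UNIV. scale_pm (v $ i) (sym_gen i))"

lemma vec_sym_zero [simp]: "vec_sym 0 = 0"
  by (simp add: vec_sym_def)

lemma vec_sym_add: "vec_sym (v + w) = vec_sym v + vec_sym w"
  by (simp add: vec_sym_def pm.scale_left_distrib sum.distrib)

lemma vec_sym_diff: "vec_sym (v - w) = vec_sym v - vec_sym w"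
  by (simp add: vec_sym_def pm.scale_left_diff_distrib sum_subtractf)

lemma vec_sym_smult: "vec_sym (c *s v) = scale_pm c (vec_sym v)"
  by (simp add: vec_sym_def pm.scale_sum_right)

lemma vec_sym_sum: "vec_sym (\<Sum>x\<in>A. f x) = (\<Sum>x\<in>A. vec_sym (f x))"
  by (induction A rule: infinite_finite_induct) (simp_all add: vec_sym_add)

lemma vec_sym_axis [simp]: "vec_sym (axis i 1) = sym_gen i"
proof -
  have "vec_sym (axis i 1) = (\<Sum>j\<in>UNIV. if j = i then sym_gen j else 0)"
    unfolding vec_sym_def by (rule sum.cong) (auto simp: axis_def)
  then show ?thesis by simp
qed

lemma black_prod_vec_sym:
  "black_prod a (vec_sym x) (vec_sym y) = (\<Sum>i\<in>UNIV. \<Sum>j\<in>UNIV. scale_pm (x $ i * y $ j) (black_prod a (sym_gen i) (sym_gen j)))"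
  by (simp add: vec_sym_def pm_linear_sum[OF pm_linear_black_prod_left[OF pm_linear_id]] black_prod_sum_right
      black_prod_scale_left black_prod_scale_right pm.scale_sum_right)
     (subst sum.swap, simp add: mult.commute)

text \<open>The inclusion of the Lie algebra as linear polynomials respects brackets, so the
  commutator relators evaluate to 0. Exchanging the summation indices in the second product reduces
  this to commutators of generators.\<close>

lemma black_prod_vec_sym_commutator:
  "black_prod a (vec_sym x) (vec_sym y) - black_prod a (vec_sym y) (vec_sym x) = vec_sym (ga_bracket a x y)"
proof -
  have comm: "black_prod a (sym_gen i) (sym_gen j) - black_prod a (sym_gen j) (sym_gen i)
      = scale_pm (a $ j) (sym_gen i) - scale_pm (a $ i) (sym_gen j)" for i j
    by (simp add: black_prod_gen_gen mult.commute)
  have "black_prod a (vec_sym y) (vec_sym x)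
      = (\<Sum>i\<in>UNIV. \<Sum>j\<in>UNIV. scale_pm (x $ i * y $ j) (black_prod a (sym_gen j) (sym_gen i)))"
    unfolding black_prod_vec_sym by (subst sum.swap) (simp add: mult.commute)
  then have "black_prod a (vec_sym x) (vec_sym y) - black_prod a (vec_sym y) (vec_sym x)
     = (\<Sum>i\<in>UNIV. \<Sum>j\<in>UNIV. scale_pm (x $ i * y $ j) (black_prod a (sym_gen i) (sym_gen j) - black_prod a (sym_gen j) (sym_gen i)))"
    unfolding black_prod_vec_sym by (simp add: sum_subtractf pm.scale_right_diff_distrib)
  also have "\<dots> = vec_sym (ga_bracket a x y)"
    unfolding ga_bracket_def vec_sym_sum vec_sym_smult vec_sym_diff vec_sym_axis
    by (simp only: comm)
  finally show ?thesis .
qed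

lemma single_Nil_one: "Poly_Mapping.single [] 1 = (1 :: 'b list \<Rightarrow>\<^sub>0 'k::zero_neq_one)"
  by (metis single_one zero_list_def)

text \<open>Folding from the left makes appending a letter immediate, in accordance with the
  inductions that multiply by a generator on the right.\<close>

definition word_eval :: "'k::field ^ 'n::finite \<Rightarrow> ('k ^ 'n) list \<Rightarrow> ('n, 'k) sym" where
  "word_eval a = foldl (\<lambda>p v. black_prod a p (vec_sym v)) 1"

lemma word_eval_Nil [simp]: "word_eval a [] = 1"
  by (simp add: word_eval_def)

lemma word_eval_snoc [simp]: "word_eval a (w @ [v]) = black_prod a (word_eval a w) (vec_sym v)"
  by (simp add: word_eval_def)

lemma word_eval_append: "word_eval a (w @ w') = black_prod a (word_eval a w) (word_eval a w')"
  by (induction w' rule: rev_induct) (simp_all add: black_prod_assoc flip: append_assoc)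

lemma word_eval_Cons: "word_eval a (v # w) = black_prod a (vec_sym v) (word_eval a w)"
  using word_eval_append[of a "[v]" w] word_eval_snoc[of a "[]" v] by simp

definition free_eval :: "'k::field ^ 'n::finite \<Rightarrow> (('k ^ 'n) list \<Rightarrow>\<^sub>0 'k) \<Rightarrow> ('n, 'k) sym" where
  "free_eval a = lin_ext (word_eval a)"

lemma pm_linear_free_eval [simp]: "pm_linear (free_eval a)"
  by (simp add: free_eval_def)

lemmas free_eval_add = pm_linear_add[OF pm_linear_free_eval]
lemmas free_eval_scale = pm_linear_scale[OF pm_linear_free_eval]
lemmas free_eval_diff = pm_linear_diff[OF pm_linear_free_eval]
lemmas free_eval_zero [simp] = pm_linear_0[OF pm_linear_free_eval]

lemma free_eval_single [simp]: "free_eval a (Poly_Mapping.single w c) = scale_pm c (word_eval a w)"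
  by (simp add: free_eval_def)

lemma free_eval_one [simp]: "free_eval a 1 = 1"
  by (simp add: free_eval_def zero_list_def)

lemma free_eval_gen [simp]: "free_eval a (free_gen v) = vec_sym v"
  using word_eval_snoc[of a "[]" v] by (simp add: free_gen_def)

lemma free_eval_mult: "free_eval a (s * t) = black_prod a (free_eval a s) (free_eval a t)"
proof (induction s rule: pm_induct)
  case (basis w)
  show ?case
    by (induction t rule: pm_induct)
       (simp_all add: mult_single plus_list_def word_eval_append distrib_left free_eval_add free_eval_scale
          black_prod_add_right black_prod_scale_right scale_pm_mult_right)
qed (simp_all add: distrib_right free_eval_add free_eval_scale black_prod_add_left black_prod_scale_left scale_pm_mult_left)

lemma free_eval_surj: "\<exists>t. free_eval a t = p"
proof (induction p rule: black_prod_induct[of _ a])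
  case (gen p i)
  then obtain t where "free_eval a t = p" by blast
  then have "free_eval a (t * free_gen (axis i 1)) = black_prod a p (sym_gen i)"
    by (simp add: free_eval_mult)
  then show ?case by blast
qed (metis free_eval_zero free_eval_one free_eval_add free_eval_scale)+

text \<open>Matches the counits: a nonempty word evaluates to a product with a linear form, which
  has constant term 0.\<close>

lemma lookup_free_eval_zero:
  fixes a :: "'k::field ^ 'n::finite"
  shows "Poly_Mapping.lookup (free_eval a t) 0 = Poly_Mapping.lookup t []"
proof (induction t rule: pm_induct)
  case (basis w)
  have "Poly_Mapping.lookup (vec_sym v) 0 = 0" for v :: "'k ^ 'n"
    by (simp add: vec_sym_def lookup_sum)
  then show ?case
    by (cases w) (simp_all add: word_eval_Cons lookup_black_prod_zero lookup_single)
qed (simp_all add: free_eval_add free_eval_scale lookup_add)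

lemma sym_comult_vec_sym: "sym_comult_alg (vec_sym v) = tens (vec_sym v) 1 + tens 1 (vec_sym v)"
  by (simp add: vec_sym_def pm_linear_sum[OF pm_linear_sym_comult] pm_linear_scale[OF pm_linear_sym_comult]
      sym_comult_gen pm_linear_sum[OF pm_linear_tens_left[OF pm_linear_id]]
      pm_linear_sum[OF pm_linear_tens_right[OF pm_linear_id]] tens_scale_left tens_scale_right
      pm.scale_right_distrib sum.distrib)

text \<open>Both sides are multiplicative with respect to \<open>black_prod2\<close> and treat
  letters as primitive. As \<open>t\<close> is arbitrary, this applies to whatever representative a
  class is given.\<close>

lemma free_eval_comult:
  "lin_ext (\<lambda>(u, v). tens (word_eval a u) (word_eval a v)) (free_comult t) = sym_comult_alg (free_eval a t)"
    (is "lin_ext ?e _ = _")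
proof (rule pm_linear_eq[where p = t])
  have mult: "lin_ext ?e (p * q) = black_prod2 a (lin_ext ?e p) (lin_ext ?e q)" for p q
  proof (induction p rule: pm_induct)
    case (basis x)
    show ?case
      by (induction q rule: pm_induct)
         (simp_all add: mult_single plus_list_def word_eval_append distrib_left lin_ext_add lin_ext_scale
            black_prod2_tens black_prod2_add_right black_prod2_scale_right scale_pm_mult_right case_prod_unfold)
  qed (simp_all add: distrib_right lin_ext_add lin_ext_scale black_prod2_add_left black_prod2_scale_left scale_pm_mult_left)
  fix w
  let ?f = "\<lambda>x. Poly_Mapping.single ([x], []) 1 + Poly_Mapping.single ([], [x]) 1"
  have "lin_ext ?e (prod_list (map ?f w)) = sym_comult_alg (word_eval a w)"
  proof (induction w)
    case (Cons x w)
    have "word_eval a [x] = vec_sym x" by (simp add: word_eval_Cons)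
    then have "lin_ext ?e (?f x) = sym_comult_alg (vec_sym x)"
      by (simp add: lin_ext_add sym_comult_vec_sym)
    then show ?case
      using Cons by (simp add: mult sym_comult_black_prod word_eval_Cons)
  qed (simp add: case_prod_unfold zero_list_def)
  then show "lin_ext ?e (free_comult (Poly_Mapping.single w 1)) = sym_comult_alg (free_eval a (Poly_Mapping.single w 1))"
    by (simp add: free_comult_def)
qed (auto simp: free_comult_def intro!: pm_linear_lin_ext_comp pm_linear_comp[OF pm_linear_sym_comult pm_linear_free_eval] pm_linear_id)

lemma ring_of_type_algebra_simps [simp]:
  "carrier (ring_of_type_algebra :: 'b::ring_1 ring) = UNIV"
  "x \<otimes>\<^bsub>ring_of_type_algebra\<^esub> y = (x * y :: 'b)" "x \<oplus>\<^bsub>ring_of_type_algebra\<^esub> y = (x + y :: 'b)"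
  "\<one>\<^bsub>ring_of_type_algebra\<^esub> = (1 :: 'b)" "\<zero>\<^bsub>ring_of_type_algebra\<^esub> = (0 :: 'b)"
  by (simp_all add: ring_of_type_algebra_def)

lemma ring_ring_of_type_algebra: "ring (ring_of_type_algebra :: 'b::ring_1 ring)"
proof (rule ringI)
  show "abelian_group (ring_of_type_algebra :: 'b ring)"
  proof (rule abelian_groupI)
    show "\<exists>y\<in>carrier ring_of_type_algebra. y \<oplus>\<^bsub>ring_of_type_algebra\<^esub> x = \<zero>\<^bsub>ring_of_type_algebra\<^esub>" for x :: 'b
      by (rule bexI[of _ "- x"]) simp_all
  qed (simp_all add: add_ac)
  show "Group.monoid (ring_of_type_algebra :: 'b ring)"
    by (rule monoidI) (simp_all add: mult.assoc)
qed (simp_all add: distrib_left distrib_right)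

lemma a_inv_ring_of_type_algebra: "\<ominus>\<^bsub>ring_of_type_algebra\<^esub> x = - (x :: 'b::ring_1)"
proof -
  interpret ring "ring_of_type_algebra :: 'b ring" by (rule ring_ring_of_type_algebra)
  show ?thesis by (rule minus_equality) simp_all
qed

section \<open>The defining ideal and the quotient\<close>

context
  fixes a :: "'k::field ^ 'n::finite"
begin

abbreviation (input) "free_alg \<equiv> ring_of_type_algebra :: (('k ^ 'n) list \<Rightarrow>\<^sub>0 'k) ring"
abbreviation (input) "env_I \<equiv> env_ideal (*s) (ga_bracket a)"
abbreviation (input) "env_rels \<equiv> env_relators (*s) (ga_bracket a)"
abbreviation (input) "env_cls \<equiv> env_class (*s) (ga_bracket a)"

lemma env_ideal: "ideal env_I free_alg"
  unfolding env_ideal_def by (rule ring.genideal_ideal[OF ring_ring_of_type_algebra]) simp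

lemma env_relators_subset: "env_rels \<subseteq> env_I"
  unfolding env_ideal_def by (rule ring.genideal_self[OF ring_ring_of_type_algebra]) simp

lemma env_ideal_mult:
  "t \<in> env_I \<Longrightarrow> s * t \<in> env_I" "t \<in> env_I \<Longrightarrow> t * s \<in> env_I"
  using ideal.I_l_closed[OF env_ideal, of t s] ideal.I_r_closed[OF env_ideal, of t s] by simp_all

lemma env_ideal_subspace: "pm.subspace env_I"
proof (rule pm.subspaceI)
  show "0 \<in> env_I"
    using additive_subgroup.zero_closed[OF ideal.axioms(1)[OF env_ideal]] by simp
  show "s + t \<in> env_I" if "s \<in> env_I" "t \<in> env_I" for s t
    using additive_subgroup.a_closed[OF ideal.axioms(1)[OF env_ideal] that] by simp
  show "scale_pm c t \<in> env_I" if "t \<in> env_I" for c t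
    using env_ideal_mult(1)[OF that] by (simp add: scale_pm_conv_mult)
qed

lemmas env_ideal_zero = pm.subspace_0[OF env_ideal_subspace]
lemmas env_ideal_add = pm.subspace_add[OF env_ideal_subspace]
lemmas env_ideal_neg = pm.subspace_neg[OF env_ideal_subspace]
lemmas env_ideal_scale = pm.subspace_scale[OF env_ideal_subspace]
lemmas env_ideal_sum = pm.subspace_sum[OF env_ideal_subspace]

lemma env_ideal_trans: "x - y \<in> env_I \<Longrightarrow> y - z \<in> env_I \<Longrightarrow> x - z \<in> env_I"
  using env_ideal_add[of "x - y" "y - z"] by simp

lemma free_eval_env_ideal: "t \<in> env_I \<Longrightarrow> free_eval a t = 0"
proof -
  have inv: "inv\<^bsub>add_monoid free_alg\<^esub> t = - t" for t
    using a_inv_ring_of_type_algebra[of t] by (simp only: a_inv_def)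
  have "ideal {t. free_eval a t = 0} free_alg"
  proof (rule idealI[OF ring_ring_of_type_algebra])
    show "subgroup {t. free_eval a t = 0} (add_monoid free_alg)"
      by (rule subgroup.intro; (simp only: inv)?; simp add: free_eval_add pm_linear_neg)
  qed (simp_all add: free_eval_mult)
  moreover have "env_rels \<subseteq> {t. free_eval a t = 0}"
    by (auto simp: env_relators_def free_eval_diff free_eval_scale vec_sym_add vec_sym_smult
        free_eval_mult black_prod_vec_sym_commutator)
  ultimately have "env_I \<subseteq> {t. free_eval a t = 0}"
    unfolding env_ideal_def by (rule ring.genideal_minimal[OF ring_ring_of_type_algebra])
  then show "t \<in> env_I \<Longrightarrow> free_eval a t = 0" by blast
qed

text \<open>Every vector is a letter of the free algebra, not only those of the basis; the relators
  of linearity reduce a letter to the basis letters.\<close>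

lemma free_gen_expand: "free_gen v - (\<Sum>i\<in>UNIV. scale_pm (v $ i) (free_gen (axis i 1))) \<in> env_I"
proof -
  have plus: "free_gen (x + y) - free_gen x - free_gen y \<in> env_I" for x y :: "'k ^ 'n"
    by (rule subsetD[OF env_relators_subset]) (auto simp: env_relators_def)
  have smult: "free_gen (c *s x) - scale_pm c (free_gen x) \<in> env_I" for c and x :: "'k ^ 'n"
    by (rule subsetD[OF env_relators_subset]) (auto simp: env_relators_def)
  have "free_gen (\<Sum>i\<in>A. v $ i *s axis i 1) - (\<Sum>i\<in>A. scale_pm (v $ i) (free_gen (axis i 1))) \<in> env_I"
    if "finite A" for A
    using that
  proof (induction A)
    case empty
    \<comment> \<open>The letter for the zero vector is a nonzero element of the free algebra; it is
      the homogeneity relator for the scalar 0.\<close>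
    then show ?case using smult[of 0 0] by simp
  next
    case (insert i A)
    show ?case
      using env_ideal_add[OF plus[of "v $ i *s axis i 1" "\<Sum>i\<in>A. v $ i *s axis i 1"] env_ideal_add[OF smult[of "v $ i" "axis i 1"] insert.IH]]
        insert.hyps by (simp add: algebra_simps)
  qed
  from this[of UNIV] show ?thesis by (simp add: basis_expansion)
qed

lemma ga_bracket_axis: "ga_bracket a (axis i 1) (axis j 1) = a $ j *s axis i 1 - a $ i *s axis j 1"
proof -
  have "ga_bracket a (axis i 1) (axis j 1) = (\<Sum>i'\<in>UNIV. \<Sum>j'\<in>UNIV. if i' = i \<and> j' = j then a $ j *s axis i 1 - a $ i *s axis j 1 else 0)"
    unfolding ga_bracket_def by (intro sum.cong refl) (auto simp: axis_def)
  also have "\<dots> = (\<Sum>i'\<in>UNIV. if i' = i then (\<Sum>j'\<in>UNIV. if j' = j then a $ j *s axis i 1 - a $ i *s axis j 1 else 0) else 0)"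
    by (intro sum.cong refl) auto
  finally show ?thesis by simp
qed

lemma free_gen_axis_commutator:
  fixes i j :: 'n
  defines "e \<equiv> \<lambda>i. free_gen (axis i 1)"
  shows "e i * e j - e j * e i - (scale_pm (a $ j) (e i) - scale_pm (a $ i) (e j)) \<in> env_I"
proof -
  have "(\<Sum>k\<in>UNIV. scale_pm (ga_bracket a (axis i 1) (axis j 1) $ k) (e k))
      = (\<Sum>k\<in>UNIV. (if k = i then scale_pm (a $ j) (e k) else 0) - (if k = j then scale_pm (a $ i) (e k) else 0))"
    unfolding ga_bracket_axis by (intro sum.cong refl) (auto simp: axis_def pm.scale_left_diff_distrib)
  also have "\<dots> = scale_pm (a $ j) (e i) - scale_pm (a $ i) (e j)"
    by (simp add: sum_subtractf)
  finally have "free_gen (ga_bracket a (axis i 1) (axis j 1)) - (scale_pm (a $ j) (e i) - scale_pm (a $ i) (e j)) \<in> env_I"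
    using free_gen_expand[of "ga_bracket a (axis i 1) (axis j 1)"] by (simp add: e_def)
  moreover have "e i * e j - e j * e i - free_gen (ga_bracket a (axis i 1) (axis j 1)) \<in> env_I"
    by (rule subsetD[OF env_relators_subset]) (auto simp: env_relators_def e_def)
  ultimately show ?thesis by (rule env_ideal_trans[rotated])
qed

lemma free_eval_kernel:
  assumes "free_eval a t = 0"
  shows "t \<in> env_I"
proof -
  let ?e = "\<lambda>i::'n. free_gen (axis i 1) :: ('k ^ 'n) list \<Rightarrow>\<^sub>0 'k"
  \<comment> \<open>The section: \<open>sym_lift\<close> is applied to right multiplication by the
    basis letters in the free algebra, where the Lie relations hold modulo the ideal.\<close>
  obtain \<Phi> where \<Phi>: "pm_linear \<Phi>" "\<Phi> 1 = (1 :: ('k ^ 'n) list \<Rightarrow>\<^sub>0 'k)"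
    "\<And>p i. \<Phi> (black_prod a p (sym_gen i)) - \<Phi> p * ?e i \<in> env_I"
  proof (rule sym_lift[of "\<lambda>i t. t * ?e i" env_I a 1])
    show "s * ?e i * ?e j - s * ?e j * ?e i - (scale_pm (a $ j) (s * ?e i) - scale_pm (a $ i) (s * ?e j)) \<in> env_I" for i j s
      using env_ideal_mult(1)[OF free_gen_axis_commutator[of i j], of s]
      by (simp add: right_diff_distrib mult.assoc scale_pm_mult_right)
  qed (auto intro: pm_linear_mult_right pm_linear_id env_ideal_subspace env_ideal_mult)
  \<comment> \<open>Evaluation followed by the section is the identity modulo the ideal, so an
    element that evaluates to 0 is congruent to the image of 0.\<close>
  have "\<Phi> (free_eval a t) - t \<in> env_I" for t
  proof (induction t rule: pm_induct)
    case (basis w)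
    have "\<Phi> (word_eval a w) - Poly_Mapping.single w 1 \<in> env_I"
    proof (induction w rule: rev_induct)
      case Nil
      then show ?case using env_ideal_zero by (simp add: \<Phi>(2) single_Nil_one)
    next
      case (snoc v w)
      let ?p = "word_eval a w"
      have "\<Phi> (word_eval a (w @ [v])) = (\<Sum>i\<in>UNIV. scale_pm (v $ i) (\<Phi> (black_prod a ?p (sym_gen i))))"
        by (simp add: vec_sym_def black_prod_sum_right black_prod_scale_right pm_linear_sum[OF \<Phi>(1)] pm_linear_scale[OF \<Phi>(1)])
      then have "\<Phi> (word_eval a (w @ [v])) - (\<Sum>i\<in>UNIV. scale_pm (v $ i) (\<Phi> ?p * ?e i))
          = (\<Sum>i\<in>UNIV. scale_pm (v $ i) (\<Phi> (black_prod a ?p (sym_gen i)) - \<Phi> ?p * ?e i))"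
        by (simp add: sum_subtractf pm.scale_right_diff_distrib)
      also have "\<dots> \<in> env_I"
        by (intro env_ideal_sum env_ideal_scale \<Phi>(3))
      finally have 1: "\<Phi> (word_eval a (w @ [v])) - (\<Sum>i\<in>UNIV. scale_pm (v $ i) (\<Phi> ?p * ?e i)) \<in> env_I" .
      have "(\<Sum>i\<in>UNIV. scale_pm (v $ i) (\<Phi> ?p * ?e i)) - \<Phi> ?p * free_gen v \<in> env_I"
        using env_ideal_neg[OF env_ideal_mult(1)[OF free_gen_expand[of v], of "\<Phi> ?p"]]
        by (simp add: right_diff_distrib sum_distrib_left scale_pm_mult_right)
      note 2 = env_ideal_trans[OF 1 this]
      have "\<Phi> ?p * free_gen v - Poly_Mapping.single (w @ [v]) 1 \<in> env_I"
        using env_ideal_mult(2)[OF snoc, of "free_gen v"]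
        by (simp add: left_diff_distrib free_gen_def mult_single plus_list_def)
      from env_ideal_trans[OF 2 this] show ?case .
    qed
    then show ?case by simp
  next
    case (add s t)
    then show ?case
      using env_ideal_add[OF add] by (simp add: free_eval_add pm_linear_add[OF \<Phi>(1)] algebra_simps)
  next
    case (scale c t)
    then show ?case
      using env_ideal_scale[OF scale, of c]
      by (simp add: free_eval_scale pm_linear_scale[OF \<Phi>(1)] pm.scale_right_diff_distrib)
  qed (simp add: pm_linear_0[OF \<Phi>(1)] env_ideal_zero)
  from env_ideal_neg[OF this[of t]] show ?thesis
    by (simp add: assms pm_linear_0[OF \<Phi>(1)])
qed

lemma free_eval_eq_iff: "free_eval a s = free_eval a t \<longleftrightarrow> s - t \<in> env_I"
  using free_eval_env_ideal[of "s - t"] free_eval_kernel[of "s - t"] by (auto simp: free_eval_diff)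

text \<open>The kernel computation makes cosets the fibres of evaluation, so statements about
  classes become equations in S.\<close>

lemma mem_env_class: "s \<in> env_cls t \<longleftrightarrow> free_eval a s = free_eval a t"
proof -
  have "s \<in> env_cls t \<longleftrightarrow> (\<exists>j\<in>env_I. s = j + t)"
    by (auto simp: env_class_def a_r_coset_def')
  also have "\<dots> \<longleftrightarrow> s - t \<in> env_I"
    by (metis add_diff_cancel_right' diff_add_cancel)
  finally show ?thesis by (simp add: free_eval_eq_iff)
qed

lemma env_class_eq_iff: "env_cls s = env_cls t \<longleftrightarrow> free_eval a s = free_eval a t"
  by (auto simp: set_eq_iff mem_env_class)

abbreviation (input) "env_H \<equiv> env_hopf (*s) (ga_bracket a)"

lemma env_hopf_simps:
  "carrier env_H = Set.range env_cls"
  "env_cls s \<otimes>\<^bsub>env_H\<^esub> env_cls t = env_cls (s * t)"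
  "env_cls s \<oplus>\<^bsub>env_H\<^esub> env_cls t = env_cls (s + t)"
  "\<one>\<^bsub>env_H\<^esub> = env_cls 1" "\<zero>\<^bsub>env_H\<^esub> = env_cls 0"
  "c \<odot>\<^bsub>env_H\<^esub> env_cls t = env_cls (scale_pm c t)"
proof -
  show "carrier env_H = Set.range env_cls"
    by (auto simp: env_hopf_def Let_def FactRing_def A_RCOSETS_def' env_class_def)
  show "env_cls s \<otimes>\<^bsub>env_H\<^esub> env_cls t = env_cls (s * t)"
    using ideal.rcoset_mult_add[OF env_ideal, of s t]
    by (simp add: env_hopf_def Let_def FactRing_def env_class_def)
  show "env_cls s \<oplus>\<^bsub>env_H\<^esub> env_cls t = env_cls (s + t)"
    using ideal.a_rcos_sum[OF env_ideal, of s t]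
    by (simp add: env_hopf_def Let_def FactRing_def env_class_def)
  show "\<one>\<^bsub>env_H\<^esub> = env_cls 1"
    by (simp add: env_hopf_def Let_def FactRing_def env_class_def)
  show "\<zero>\<^bsub>env_H\<^esub> = env_cls 0"
    by (auto simp: env_hopf_def Let_def FactRing_def env_class_def a_r_coset_def')
  \<comment> \<open>All cosets in this union coincide, since evaluation is linear.\<close>
  have "(\<Union>s\<in>env_cls t. env_cls (scale_pm c s)) = env_cls (scale_pm c t)"
    by (auto simp: mem_env_class free_eval_scale)
  then show "c \<odot>\<^bsub>env_H\<^esub> env_cls t = env_cls (scale_pm c t)"
    by (simp add: env_hopf_def Let_def)
qed

text \<open>The representative is chosen by the same term as in the coproduct and counit of
  \<open>env_hopf\<close>, so all three refer to the same element of the free algebra.\<close>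

definition class_eval where "class_eval C = free_eval a (SOME t. t \<in> C)"

lemma class_eval_env_class [simp]: "class_eval (env_cls t) = free_eval a t"
proof -
  have "(SOME s. s \<in> env_cls t) \<in> env_cls t"
    by (rule someI[of _ t]) (simp add: mem_env_class)
  then show ?thesis by (simp add: class_eval_def mem_env_class)
qed

lemma sym_model_env_hopf: "sym_model a env_H class_eval"
proof unfold_locales
  show "bij_betw class_eval (carrier env_H) UNIV"
    unfolding bij_betw_def inj_on_def env_hopf_simps
    using free_eval_surj[of a] by (auto simp: env_class_eq_iff image_iff) (metis class_eval_env_class)
  show "Poly_Mapping.keys (comult env_H x) \<subseteq> carrier env_H \<times> carrier env_H" for x
    unfolding env_hopf_simps by (auto simp: env_hopf_def Let_def intro!: keys_lin_ext)
  show "lin_ext (\<lambda>(y, z). tens (class_eval y) (class_eval z)) (comult env_H x) = sym_comult_alg (class_eval x)" for x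
    using free_eval_comult[of a "SOME t. t \<in> x"]
    by (simp add: env_hopf_def Let_def lin_ext_lin_ext case_prod_unfold class_eval_def[of x])
  show "counit env_H x = Poly_Mapping.lookup (class_eval x) 0" for x
    by (simp add: env_hopf_def Let_def class_eval_def lookup_free_eval_zero)
qed (auto simp: env_hopf_simps free_eval_mult free_eval_add free_eval_scale)

end

theorem proposition6:
  fixes a :: "'k::field ^ 'n::finite"
  shows "(\<exists>!tri. black_product a tri) \<and>
    (\<forall>tri. black_product a tri \<longrightarrow>
      (\<forall>x y z. tri (tri x y) z = tri x (tri y z)) \<and>
      hopf_algebra (sym_hopf tri) \<and>
      hopf_algebra (env_hopf (*s) (ga_bracket a)) \<and>
      hopf_iso (sym_hopf tri) (env_hopf (*s) (ga_bracket a)) \<noteq> {})"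
proof -
  have "\<exists>!tri. black_product a tri"
    using black_product_black_prod black_product_unique by metis
  moreover have "hopf_algebra (sym_hopf (black_prod a))"
    by (rule sym_model.hopf_algebra[OF sym_model_sym_hopf])
  moreover have "hopf_algebra (env_hopf (*s) (ga_bracket a))"
    by (rule sym_model.hopf_algebra[OF sym_model_env_hopf])
  moreover have "hopf_iso (sym_hopf (black_prod a)) (env_hopf (*s) (ga_bracket a)) \<noteq> {}"
    using sym_model.from_sym_hopf_iso[OF sym_model_env_hopf] by blast
  ultimately show ?thesis
    using black_product_unique black_prod_assoc by metis
qed

end
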